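(* Let $(X,d)$ be a compact metric space, let $f:X\to X$ be a continuous map, and let $\mu$ be an $f$-invariant Borel probability measure which is $f$-homogeneous. Suppose that there exist constants $\Lambda,\lambda>1$ and $\delta>0$ such that, for each $x,y\in X$ with $d(x,y)<\delta$, $$\lambda\, d(x,y)\le d(f(x),f(y))\le\Lambda\, d(x,y).$$ Then, for each real $s<1$ and each real $q>1$, $$\frac{h_\mu(f)}{\log\Lambda}\le D^-_\mu(q)\le D^-_\mu(1)\le D^+_\mu(1)\le D^+_\mu(s)\le\frac{h_\mu(f)}{\log\lambda}.$$
   Context: $h_\mu(f)$ is the metric (Kolmogorov–Sinai) entropy. $B(x,\varepsilon)$ is the open ball of radius $\varepsilon$ centered at $x$, and $\operatorname{supp}(\mu)$ is the topological support of $\mu$. Homogeneous measures: with the Bowen ball $B(x,n,\varepsilon)=\{y\in X: d(f^i(x),f^i(y))<\varepsilon,\ i=0,\dots,n\}$, a Borel probability measure $\mu$ on $X$ is $f$-homogeneous if for each $\varepsilon>0$ there exist $\delta>0$ and $c>0$ such that, for each $n\in\mathbb{N}$ and each $x,y\in X$, $\mu(B(y,n,\delta))\le c\,\mu(B(x,n,\varepsilon))$. Generalized fractal dimensions: for $q\in\mathbb{R}\setminus\{1\}$ and $\varepsilon\in(0,1)$ put $I_\mu(q,\varepsilon)=\int_{\operatorname{supp}(\mu)}\mu(B(x,\varepsilon))^{q-1}\,d\mu(x)$, and $$D^+_\mu(q)=\limsup_{\varepsilon\downarrow0}\frac{\log I_\mu(q,\varepsilon)}{(q-1)\log\varepsilon},\qquad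 D^-_\mu(q)=\liminf_{\varepsilon\downarrow0}\frac{\log I_\mu(q,\varepsilon)}{(q-1)\log\varepsilon}.$$ For $q=1$, $D^+_\mu(1)$ and $D^-_\mu(1)$ are respectively the $\limsup$ and the $\liminf$, as $\varepsilon\downarrow0$, of $\frac{\int_{\operatorname{supp}(\mu)}\log\mu(B(x,\varepsilon))\,d\mu(x)}{\log\varepsilon}$. *)

theory Defs
  imports "HOL-Probability.Probability"
begin

section \<open>Metric entropy\<close>

text \<open>The logarithm is natural. Since \<open>ln 0 = 0\<close> in HOL, null atoms contribute \<open>0\<close>.\<close>

definition partition_entropy :: "'a measure \<Rightarrow> 'a set set \<Rightarrow> real" where
  "partition_entropy M P = - (\<Sum>A\<in>P. measure M A * ln (measure M A))"

definition finite_measurable_partition :: "'a measure \<Rightarrow> 'a set set \<Rightarrow> bool" where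
  "finite_measurable_partition M P \<longleftrightarrow> finite P \<and> P \<subseteq> sets M \<and> partition_on (space M) P"

text \<open>The common refinement of the preimages of \<open>P\<close> under \<open>f ^^ i\<close>, \<open>i < n\<close>. Distinct
  itineraries \<open>C\<close> give disjoint atoms, so passing to the set of atoms identifies only empty
  ones, and these do not contribute to the entropy.\<close>

definition iterated_join :: "'a measure \<Rightarrow> ('a \<Rightarrow> 'a) \<Rightarrow> 'a set set \<Rightarrow> nat \<Rightarrow> 'a set set" where
  "iterated_join M f P n =
     (\<lambda>C. {x \<in> space M. \<forall>i<n. (f ^^ i) x \<in> C i}) ` ({..<n} \<rightarrow>\<^sub>E P)"

text \<open>For \<open>f\<close> preserving the probability measure \<open>M\<close> the limit exists in the reals, by
  subadditivity.\<close>

definition entropy_wrt_partition :: "'a measure \<Rightarrow> ('a \<Rightarrow> 'a) \<Rightarrow> 'a set set \<Rightarrow> real" where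
  "entropy_wrt_partition M f P = lim (\<lambda>n. partition_entropy M (iterated_join M f P n) / real n)"

definition metric_entropy :: "'a measure \<Rightarrow> ('a \<Rightarrow> 'a) \<Rightarrow> ereal" where
  "metric_entropy M f =
     (SUP P\<in>{P. finite_measurable_partition M P}. ereal (entropy_wrt_partition M f P))"

section \<open>Invariant and homogeneous measures\<close>

definition invariant_measure :: "'a measure \<Rightarrow> ('a \<Rightarrow> 'a) \<Rightarrow> bool" where
  "invariant_measure M f \<longleftrightarrow>
     f \<in> measurable M M \<and> (\<forall>A\<in>sets M. emeasure M (f -` A \<inter> space M) = emeasure M A)"

text \<open>The time index runs up to and including \<open>n\<close>.\<close>

definition bowen_ball :: "('a::metric_space \<Rightarrow> 'a) \<Rightarrow> 'a \<Rightarrow> nat \<Rightarrow> real \<Rightarrow> 'a set" where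
  "bowen_ball f x n \<epsilon> = {y. \<forall>i\<le>n. dist ((f ^^ i) x) ((f ^^ i) y) < \<epsilon>}"

definition homogeneous_measure :: "'a::metric_space measure \<Rightarrow> ('a \<Rightarrow> 'a) \<Rightarrow> bool" where
  "homogeneous_measure M f \<longleftrightarrow>
     (\<forall>\<epsilon>>0. \<exists>\<delta>>0. \<exists>c>0. \<forall>n x y.
        measure M (bowen_ball f y n \<delta>) \<le> c * measure M (bowen_ball f x n \<epsilon>))"

section \<open>Generalized fractal dimensions\<close>

definition measure_support :: "'a::topological_space measure \<Rightarrow> 'a set" where
  "measure_support M = {x. \<forall>U. open U \<and> x \<in> U \<longrightarrow> emeasure M U > 0}"

text \<open>Balls around points of the support have positive measure, so \<open>powr\<close> and \<open>ln\<close> below are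
  applied to positive reals only. On a compact space, for fixed \<open>\<epsilon> > 0\<close>, these measures are
  moreover bounded away from \<open>0\<close> on the support; hence both integrands are bounded, and the
  Bochner integrals are the usual finite integrals, for every real \<open>q\<close>.\<close>

definition energy_integral :: "'a::metric_space measure \<Rightarrow> real \<Rightarrow> real \<Rightarrow> real" where
  "energy_integral M q \<epsilon> = (LINT x:measure_support M|M. measure M (ball x \<epsilon>) powr (q - 1))"

definition dimension_quotient :: "'a::metric_space measure \<Rightarrow> real \<Rightarrow> real \<Rightarrow> real" where
  "dimension_quotient M q \<epsilon> =
     (if q = 1 then (LINT x:measure_support M|M. ln (measure M (ball x \<epsilon>))) / ln \<epsilon>
      else ln (energy_integral M q \<epsilon>) / ((q - 1) * ln \<epsilon>))"

definition upper_dimension :: "'a::metric_space measure \<Rightarrow> real \<Rightarrow> ereal" where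
  "upper_dimension M q = Limsup (at_right 0) (\<lambda>\<epsilon>. ereal (dimension_quotient M q \<epsilon>))"

definition lower_dimension :: "'a::metric_space measure \<Rightarrow> real \<Rightarrow> ereal" where
  "lower_dimension M q = Liminf (at_right 0) (\<lambda>\<epsilon>. ereal (dimension_quotient M q \<epsilon>))"

end

theory Submission
  imports Defs
begin

text \<open>Homogeneity makes all Bowen balls of the same length comparable in measure, so entropy and
  the measures of metric balls can be compared uniformly in the centre. A partition into sets
  of small diameter has iterated atoms inside Bowen balls, so its entropy dominates the
  decay rate of their measures. Conversely, a maximal disjoint family of Bowen balls of measure
  at least \<open>m\<close> has at most \<open>1 / m\<close> members, and the balls of twice the radius cover the space;
  this bounds the entropy of any partition by the decay rate. The expansion bounds nest
  metric balls and Bowen balls at scales \<open>\<Lambda>\<close> and \<open>\<lambda>\<close> to the power \<open>-n\<close>, and the inequalities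
  between the dimensions are Jensen's inequality at each scale.\<close>

section \<open>Subadditive sequences\<close>

text \<open>The two ends of the chain are not symmetric. Metric entropy is a supremum over
  partitions, so its lower comparison has to treat an arbitrary partition, whose atoms may come
  arbitrarily close to each other, while the upper one may choose a single partition adapted to the
  radius that homogeneity yields for \<open>\<delta>\<close>. In both, homogeneity costs an additive
  constant \<open>ln c\<close>, and rounding the time index to fit a scale \<open>\<epsilon>\<close>
  costs another bounded term; both vanish after division by \<open>ln \<epsilon>\<close>. Bounds on
  \<open>ln (measure M (ball x \<epsilon>))\<close> that are uniform in \<open>x\<close> then
  control the energy integrals: an upper bound on ball measures for \<open>q > 1\<close> and a lower
  bound for \<open>s < 1\<close> each bound the integral from above, and the sign of
  \<open>(q - 1) * ln \<epsilon>\<close> turns these into opposite inequalities for the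
  dimensions.\<close>

text \<open>Fekete's lemma. The limit is the infimum of the quotients: fix \<open>m\<close> whose
  quotient nearly attains it and divide \<open>n\<close> by \<open>m\<close> with remainder.\<close>

lemma subadditive_converges:
  fixes a :: "nat \<Rightarrow> real"
  assumes nonneg: "\<And>n. 0 \<le> a n" and sub: "\<And>m n. a (m + n) \<le> a m + a n"
  shows "convergent (\<lambda>n. a n / real n)"
proof -
  \<comment> \<open>Index 0 is left out: \<open>a 0 / real 0\<close> is 0 in HOL and would pull the
    infimum down to 0.\<close>
  define S where "S = (\<lambda>n. a n / real n) ` {1..}"
  have bdd: "bdd_below S"
    by (rule bdd_belowI[of _ 0]) (auto simp: S_def nonneg)
  have lower: "Inf S \<le> a n / real n" if "n \<ge> 1" for n
    using that by (intro cInf_lower[OF _ bdd]) (auto simp: S_def)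
  have mult: "a (k * m + r) \<le> real k * a m + a r" for k m r
  proof (induction k)
    case (Suc k)
    have "a (Suc k * m + r) \<le> a m + a (k * m + r)"
      using sub[of m "k * m + r"] by (simp add: add.assoc)
    with Suc show ?case by (simp add: algebra_simps)
  qed simp
  have "(\<lambda>n. a n / real n) \<longlonglongrightarrow> Inf S"
  proof (rule LIMSEQ_I)
    fix e :: real assume "e > 0"
    then have "Inf S < Inf S + e / 2" by simp
    moreover have "S \<noteq> {}" by (auto simp: S_def)
    ultimately obtain m where m: "m \<ge> 1" "a m / real m < Inf S + e / 2"
      using cInf_lessD[of S "Inf S + e / 2"] by (auto simp: S_def)
    \<comment> \<open>Bounds the contribution of every possible remainder modulo \<open>m\<close>,
      independently of \<open>n\<close>.\<close>
    define C where "C = (\<Sum>r<m. a r)"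
    obtain N :: nat where N: "2 * C / e < real N" using reals_Archimedean2 by blast
    have "norm (a n / real n - Inf S) < e" if n: "n \<ge> max N 1" for n
    proof -
      have "a (n mod m) \<le> C"
        unfolding C_def using m by (intro member_le_sum) (auto simp: nonneg)
      moreover have "a n \<le> real (n div m) * a m + a (n mod m)"
        using mult[of "n div m" m "n mod m"] by simp
      moreover have "real (n div m) * a m \<le> real n / real m * a m"
        by (intro mult_right_mono nonneg) (simp add: of_nat_div_le_of_nat)
      ultimately have "a n \<le> real n / real m * a m + C" by linarith
      then have "a n / real n \<le> a m / real m + C / real n"
        using n m by (simp add: field_simps)
      moreover have "C / real n < e / 2"
      proof -
        have "2 * C / e < real n" using N n by linarith
        then show ?thesis using \<open>e > 0\<close> n by (simp add: field_simps)
      qed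
      ultimately have "a n / real n < Inf S + e" using m(2) by linarith
      with lower[of n] n show ?thesis by simp
    qed
    then show "\<exists>N. \<forall>n\<ge>N. norm (a n / real n - Inf S) < e" by blast
  qed
  then show ?thesis by (rule convergentI)
qed

section \<open>Regularity and separation in metric spaces\<close>

text \<open>Inner approximation by closed sets alone is not visibly stable under complements. The
  induction therefore also carries an open superset, and complementation exchanges the two
  approximations.\<close>

lemma closed_inner_regular:
  fixes M :: "'a::metric_space measure"
  assumes fin: "finite_measure M" and sets: "sets M = sets borel"
    and A: "A \<in> sets borel" and e: "e > 0"
  obtains C where "closed C" "C \<subseteq> A" "measure M (A - C) < e"
proof -
  interpret finite_measure M by fact
  have op[measurable]: "U \<in> sets M" if "open U" for U using that by (simp add: sets)
  have cl[measurable]: "C \<in> sets M" if "closed C" for C using that by (simp add: sets)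
  have "A \<in> sigma_sets UNIV {S. open S}" using A by (simp add: borel_def)
  then have "\<forall>e>0. \<exists>C U. closed C \<and> open U \<and> C \<subseteq> A \<and> A \<subseteq> U \<and> measure M (U - C) < e"
  proof (induction A)
    case (Basic A)
    then have A: "open A" by simp
    show ?case
    proof (intro allI impI)
      fix e :: real assume "e > 0"
      \<comment> \<open>An open set is the increasing union of the sets of points that keep a fixed
        distance from its complement.\<close>
      define C where "C n = {x. ball x (1 / real (Suc n)) \<subseteq> A}" for n
      have "- C n = (\<Union>y\<in>-A. ball y (1 / real (Suc n)))" for n
        by (force simp: C_def dist_commute)
      then have C: "closed (C n)" for n
        unfolding closed_def by (auto intro!: open_UN)
      have "C n \<subseteq> A" for n by (force simp: C_def)
      moreover have "x \<in> (\<Union>n. C n)" if "x \<in> A" for x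
      proof -
        obtain d where d: "d > 0" "ball x d \<subseteq> A" using A \<open>x \<in> A\<close> open_contains_ball by blast
        obtain n where "inverse (real (Suc n)) < d" using d(1) reals_Archimedean by blast
        then have "ball x (1 / real (Suc n)) \<subseteq> ball x d"
          by (intro subset_ball) (simp add: divide_simps)
        with d(2) show ?thesis unfolding C_def by blast
      qed
      ultimately have un: "(\<Union>n. C n) = A" by blast
      have "incseq C"
      proof (rule incseq_SucI)
        show "C n \<subseteq> C (Suc n)" for n
        proof -
          have "ball x (1 / real (Suc (Suc n))) \<subseteq> ball x (1 / real (Suc n))" for x :: 'a
            by (intro subset_ball) (simp add: field_simps)
          then show ?thesis unfolding C_def by blast
        qed
      qed
      then have "(\<lambda>n. measure M (C n)) \<longlonglongrightarrow> measure M A"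
        using finite_Lim_measure_incseq[of C] C un by (simp add: image_subset_iff)
      then have "eventually (\<lambda>n. measure M A - e < measure M (C n)) sequentially"
        using \<open>e > 0\<close> by (intro order_tendstoD) auto
      then obtain n where "measure M A - e < measure M (C n)"
        using eventually_happens'[OF sequentially_bot] by blast
      moreover have "measure M (A - C n) = measure M A - measure M (C n)"
        using A C \<open>\<And>n. C n \<subseteq> A\<close> by (intro finite_measure_Diff) auto
      ultimately show "\<exists>C U. closed C \<and> open U \<and> C \<subseteq> A \<and> A \<subseteq> U \<and> measure M (U - C) < e"
        using A C \<open>\<And>n. C n \<subseteq> A\<close> by (intro exI[of _ "C n"] exI[of _ A]) auto
    qed
  next
    case Empty
    then show ?case by (auto intro!: exI[of _ "{}"])
  next
    case (Compl A)
    show ?case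
    proof (intro allI impI)
      fix e :: real assume "e > 0"
      with Compl.IH obtain C U where CU: "closed C" "open U" "C \<subseteq> A" "A \<subseteq> U"
        "measure M (U - C) < e"
        by metis
      have "-C - -U = U - C" by blast
      then have "closed (-U) \<and> open (-C) \<and> -U \<subseteq> UNIV - A \<and> UNIV - A \<subseteq> -C
          \<and> measure M (-C - -U) < e"
        using CU by (simp add: closed_Compl open_Compl) blast
      then show "\<exists>C U. closed C \<and> open U \<and> C \<subseteq> UNIV - A \<and> UNIV - A \<subseteq> U
          \<and> measure M (U - C) < e"
        by blast
    qed
  next
    case (Union A)
    show ?case
    proof (intro allI impI)
      fix e :: real assume e: "e > 0"
      \<comment> \<open>Half of \<open>e\<close> is distributed geometrically over the sets
        \<open>A i\<close>. The other half pays for truncating the union of the \<open>C i\<close>,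
        which need not be closed, to the finite union \<open>D n\<close>.\<close>
      have "e / 2 * (1 / 2) ^ Suc i > 0" for i using e by simp
      then have "\<forall>i. \<exists>C U. closed C \<and> open U \<and> C \<subseteq> A i \<and> A i \<subseteq> U
          \<and> measure M (U - C) < e / 2 * (1 / 2) ^ Suc i"
        using Union.IH by blast
      then obtain C U where CU: "\<And>i. closed (C i)" "\<And>i. open (U i)" "\<And>i. C i \<subseteq> A i"
        "\<And>i. A i \<subseteq> U i" "\<And>i. measure M (U i - C i) < e / 2 * (1 / 2) ^ Suc i"
        by metis
      have UN[measurable]: "(\<Union>i. U i) \<in> sets M" "(\<Union>i. C i) \<in> sets M"
        using CU(1,2) by (auto intro!: op open_UN sets.countable_UN intro: cl simp: image_subset_iff)
      have sums: "(\<lambda>i. e / 2 * (1 / 2) ^ Suc i) sums (e / 2)"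
        using sums_mult[OF power_half_series, of "e / 2"] by simp
      have summ: "summable (\<lambda>i. measure M (U i - C i))"
        by (rule summable_comparison_test'[OF sums_summable[OF sums]])
           (use CU(5) in \<open>auto intro: less_imp_le\<close>)
      have "measure M ((\<Union>i. U i) - (\<Union>i. C i)) \<le> measure M (\<Union>i. U i - C i)"
        using CU by (intro finite_measure_mono) auto
      also have "\<dots> \<le> (\<Sum>i. measure M (U i - C i))"
        using CU by (intro finite_measure_subadditive_countably summ) auto
      also have "\<dots> \<le> (\<Sum>i. e / 2 * (1 / 2) ^ Suc i)"
        using CU(5) by (intro suminf_le summ sums_summable[OF sums] less_imp_le)
      also have "\<dots> = e / 2" using sums by (rule sums_unique[symmetric])
      finally have 1: "measure M ((\<Union>i. U i) - (\<Union>i. C i)) \<le> e / 2" .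
      define D where "D n = (\<Union>i\<le>n. C i)" for n
      have D: "closed (D n)" for n unfolding D_def using CU by (intro closed_UN) auto
      have "incseq D" unfolding D_def by (intro incseq_SucI UN_mono) auto
      moreover have "(\<Union>n. D n) = (\<Union>i. C i)" unfolding D_def by auto
      ultimately have "(\<lambda>n. measure M (D n)) \<longlonglongrightarrow> measure M (\<Union>i. C i)"
        using finite_Lim_measure_incseq[of D] D by (simp add: image_subset_iff)
      then have "eventually (\<lambda>n. measure M (\<Union>i. C i) - e / 2 < measure M (D n)) sequentially"
        using e by (intro order_tendstoD) auto
      then obtain n where n: "measure M (\<Union>i. C i) - e / 2 < measure M (D n)"
        using eventually_happens'[OF sequentially_bot] by blast
      have CA: "(\<Union>i. C i) \<subseteq> (\<Union>i. A i)" "(\<Union>i. A i) \<subseteq> (\<Union>i. U i)"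
        by (intro UN_mono CU subset_refl)+
      have sub: "D n \<subseteq> (\<Union>i. C i)" "(\<Union>i. C i) \<subseteq> (\<Union>i. U i)"
        using CA unfolding D_def by auto
      have "measure M ((\<Union>i. U i) - D n) = measure M (\<Union>i. U i) - measure M (D n)"
        "measure M ((\<Union>i. U i) - (\<Union>i. C i)) = measure M (\<Union>i. U i) - measure M (\<Union>i. C i)"
        using D sub by (auto intro!: finite_measure_Diff)
      with 1 n have "measure M ((\<Union>i. U i) - D n) < e" by linarith
      then show "\<exists>C U. closed C \<and> open U \<and> C \<subseteq> \<Union>(range A) \<and> \<Union>(range A) \<subseteq> U
          \<and> measure M (U - C) < e"
        using D[of n] CU(2) CA sub(1)
        by (intro exI[of _ "D n"] exI[of _ "\<Union>i. U i"]) (simp add: open_UN)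
    qed
  qed
  with e obtain C U where CU: "closed C" "open U" "C \<subseteq> A" "A \<subseteq> U" "measure M (U - C) < e"
    by metis
  then have "measure M (A - C) \<le> measure M (U - C)"
    using op[OF CU(2)] cl[OF CU(1)] by (intro finite_measure_mono Diff_mono) auto
  with CU show thesis by (intro that[of C]) simp_all
qed

text \<open>The distance is positive and continuous on the compact set \<open>Z\<close> of pairs
  taken from different members, so its minimum there serves as \<open>r\<close>.\<close>

lemma disjoint_compacts_separated:
  fixes K :: "'i \<Rightarrow> 'a::metric_space set"
  assumes fin: "finite I" and K: "\<And>i. i \<in> I \<Longrightarrow> compact (K i)"
    and disj: "\<And>i j. i \<in> I \<Longrightarrow> j \<in> I \<Longrightarrow> i \<noteq> j \<Longrightarrow> K i \<inter> K j = {}"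
  obtains r where "r > 0"
    "\<And>i j x y. i \<in> I \<Longrightarrow> j \<in> I \<Longrightarrow> x \<in> K i \<Longrightarrow> y \<in> K j \<Longrightarrow> dist x y < r \<Longrightarrow> i = j"
proof -
  define Z where "Z = (\<Union>i\<in>I. \<Union>j\<in>I - {i}. K i \<times> K j)"
  have "compact Z"
    unfolding Z_def using fin K by (intro compact_UN compact_Times) auto
  have pos: "dist (fst p) (snd p) > 0" if "p \<in> Z" for p
    using that disj unfolding Z_def by fastforce
  have "\<exists>r>0. \<forall>p\<in>Z. r \<le> dist (fst p) (snd p)"
  proof (cases "Z = {}")
    case False
    have "continuous_on Z (\<lambda>p. dist (fst p) (snd p))" by (intro continuous_intros)
    from continuous_attains_inf[OF \<open>compact Z\<close> False this]
    obtain p where "p \<in> Z" "\<forall>q\<in>Z. dist (fst p) (snd p) \<le> dist (fst q) (snd q)" ..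
    with pos show ?thesis by blast
  qed (auto intro: exI[of _ 1])
  then obtain r where r: "r > 0" "\<And>p. p \<in> Z \<Longrightarrow> r \<le> dist (fst p) (snd p)" by blast
  have "i = j" if "i \<in> I" "j \<in> I" "x \<in> K i" "y \<in> K j" "dist x y < r" for i j x y
    using that r(2)[of "(x, y)"] unfolding Z_def by fastforce
  with r(1) show thesis by (rule that)
qed

section \<open>Shannon entropy and itineraries\<close>

text \<open>Partitions are treated as finite-valued functions through their fibres. Joins then
  become pairs and coarsenings become compositions, the forms in which the library states its
  information inequalities.\<close>

definition (in prob_space) shannon_entropy :: "('a \<Rightarrow> 'b) \<Rightarrow> real" where
  "shannon_entropy X =
     - (\<Sum>a\<in>X ` space M. prob (X -` {a} \<inter> space M) * ln (prob (X -` {a} \<inter> space M)))"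

text \<open>Gives measurability of functions such as itineraries without examining their fibres;
  \<open>g\<close> evaluates \<open>Y\<close> at a chosen representative of each fibre of
  \<open>X\<close>.\<close>

lemma simple_function_determined:
  assumes X: "simple_function M X"
    and det: "\<And>x y. x \<in> space M \<Longrightarrow> y \<in> space M \<Longrightarrow> X x = X y \<Longrightarrow> Y x = Y y"
  obtains g where "\<And>x. x \<in> space M \<Longrightarrow> Y x = g (X x)" "simple_function M Y"
proof -
  define g where "g = (\<lambda>a. Y (SOME x. x \<in> space M \<and> X x = a))"
  have g: "Y x = g (X x)" if "x \<in> space M" for x
  proof -
    have "(SOME z. z \<in> space M \<and> X z = X x) \<in> space M
        \<and> X (SOME z. z \<in> space M \<and> X z = X x) = X x"
      by (rule someI[of _ x]) (use that in auto)
    then show ?thesis unfolding g_def using det that by metis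
  qed
  have "simple_function M (g \<circ> X)" using X by (rule simple_function_compose)
  then have "simple_function M Y" using g by (subst simple_function_cong[of _ _ "g \<circ> X"]) auto
  with g show thesis by (rule that)
qed

context prob_space
begin

text \<open>Base \<open>exp 1\<close> makes the library's \<open>log\<close> the natural
  logarithm.\<close>

interpretation information_space M "exp 1"
  by unfold_locales simp

lemma shannon_entropy_eq:
  assumes "simple_function M X"
  shows "shannon_entropy X = entropy (exp 1) (count_space (X ` space M)) X"
  unfolding shannon_entropy_def
  by (subst entropy_simple_distributed[OF simple_distributedI[OF assms measure_nonneg refl]])
     (simp add: log_def)

lemma shannon_entropy_cong:
  assumes "\<And>x. x \<in> space M \<Longrightarrow> X x = Y x"
  shows "shannon_entropy X = shannon_entropy Y"
proof -
  have "X ` space M = Y ` space M" "X -` {a} \<inter> space M = Y -` {a} \<inter> space M" for a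
    using assms by auto
  then show ?thesis unfolding shannon_entropy_def by simp
qed

lemma shannon_entropy_superset:
  assumes "finite B" "X ` space M \<subseteq> B"
  shows "shannon_entropy X =
    - (\<Sum>a\<in>B. prob (X -` {a} \<inter> space M) * ln (prob (X -` {a} \<inter> space M)))"
proof -
  have "X -` {a} \<inter> space M = {}" if "a \<notin> X ` space M" for a using that by auto
  then show ?thesis unfolding shannon_entropy_def
    using assms by (intro arg_cong[of _ _ uminus] sum.mono_neutral_left) auto
qed

lemma shannon_entropy_nonneg: "0 \<le> shannon_entropy X"
proof -
  have "p * ln p \<le> 0" if "0 \<le> p" "p \<le> 1" for p :: real
    using that by (cases "p = 0") (auto simp: mult_le_0_iff)
  then show ?thesis unfolding shannon_entropy_def by (simp add: sum_nonpos)
qed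

lemma shannon_entropy_determined_le:
  assumes X: "simple_function M X"
    and det: "\<And>x y. x \<in> space M \<Longrightarrow> y \<in> space M \<Longrightarrow> X x = X y \<Longrightarrow> Y x = Y y"
  shows "shannon_entropy Y \<le> shannon_entropy X"
proof -
  obtain g where g: "\<And>x. x \<in> space M \<Longrightarrow> Y x = g (X x)" "simple_function M Y"
    by (rule simple_function_determined[OF X, of Y]) (rule det, assumption+, blast)
  have "shannon_entropy Y = shannon_entropy (g \<circ> X)" using g by (intro shannon_entropy_cong) auto
  also have "\<dots> \<le> shannon_entropy X"
    using entropy_data_processing[OF X, of g] X by (simp add: shannon_entropy_eq simple_function_compose)
  finally show ?thesis .
qed

lemma shannon_entropy_Pair_le:
  assumes X: "simple_function M X" and Y: "simple_function M Y"
  shows "shannon_entropy (\<lambda>x. (X x, Y x)) \<le> shannon_entropy X + shannon_entropy Y"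
  using entropy_chain_rule[OF X Y] conditional_entropy_less_eq_entropy[OF Y X]
  by (simp add: shannon_entropy_eq X Y simple_function_Pair)

lemma shannon_entropy_le_ln_card:
  assumes X: "simple_function M X"
  shows "shannon_entropy X \<le> ln (real (card (X ` space M)))"
  using entropy_le_card[OF simple_distributedI[OF X measure_nonneg refl]]
  by (simp add: shannon_entropy_eq X log_def)

text \<open>The entropy is the mean of \<open>- ln\<close> of the fibre probabilities, each of which
  is at least \<open>- ln p\<close>. Null fibres drop out, so \<open>ln\<close> is compared only at
  positive numbers.\<close>

lemma shannon_entropy_ge_minus_ln:
  assumes X: "simple_function M X"
    and le: "\<And>a. prob (X -` {a} \<inter> space M) \<le> p"
  shows "- ln p \<le> shannon_entropy X"
proof -
  let ?p = "\<lambda>a. prob (X -` {a} \<inter> space M)"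
  have "(\<Sum>a\<in>X ` space M. ?p a) = 1"
    using simple_distributed_sum_space[OF simple_distributedI[OF X measure_nonneg refl]] .
  then have "ln p = (\<Sum>a\<in>X ` space M. ?p a * ln p)" by (simp flip: sum_distrib_right)
  also have "\<dots> \<ge> (\<Sum>a\<in>X ` space M. ?p a * ln (?p a))"
  proof (rule sum_mono)
    fix a show "?p a * ln (?p a) \<le> ?p a * ln p"
    proof (cases "?p a = 0")
      case False
      then have "0 < ?p a" by (simp add: zero_less_measure_iff)
      then show ?thesis using le[of a] by (intro mult_left_mono) auto
    qed simp
  qed
  finally show ?thesis unfolding shannon_entropy_def by simp
qed

text \<open>The value \<open>b\<close> has probability close to 1 and costs at most the total mass
  of the other values; each of those costs at most \<open>2 * sqrt t\<close>. Both costs tend to 0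
  with \<open>t\<close>.\<close>

lemma shannon_entropy_le_of_dominant_value:
  assumes fin: "finite B" and img: "X ` space M \<subseteq> insert b B"
    and small: "\<And>a. a \<in> B \<Longrightarrow> prob (X -` {a} \<inter> space M) \<le> t"
    and X: "simple_function M X" and t: "0 \<le> t"
  shows "shannon_entropy X \<le> real (card B) * (t + 2 * sqrt t)"
proof -
  let ?p = "\<lambda>a. prob (X -` {a} \<inter> space M)"
  have B: "finite (insert b (B - {b}))" "X ` space M \<subseteq> insert b (B - {b})" using fin img by auto
  have sum1: "(\<Sum>a\<in>insert b (B - {b}). ?p a) = 1"
  proof -
    have "(\<Sum>a\<in>X ` space M. ?p a) = 1"
      using simple_distributed_sum_space[OF simple_distributedI[OF X measure_nonneg refl]] .
    moreover have "X -` {a} \<inter> space M = {}" if "a \<notin> X ` space M" for a using that by auto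
    ultimately show ?thesis
      using B by (subst sum.mono_neutral_right[of _ "X ` space M"]) auto
  qed
  have "- (?p b * ln (?p b)) \<le> 1 - ?p b"
  proof (cases "?p b = 0")
    case False
    then have p: "0 < ?p b" by (simp add: zero_less_measure_iff)
    have "ln (1 / ?p b) \<le> 1 / ?p b - 1" using p by (intro ln_le_minus_one) simp
    then have "?p b * (- ln (?p b)) \<le> ?p b * (1 / ?p b - 1)"
      using p by (intro mult_left_mono) (auto simp: ln_div)
    with p show ?thesis by (simp add: algebra_simps)
  qed simp
  also have "\<dots> = (\<Sum>a\<in>B - {b}. ?p a)"
    using sum1 sum.insert[of "B - {b}" b ?p] fin by simp
  also have "\<dots> \<le> (\<Sum>a\<in>B - {b}. t)" using small by (intro sum_mono) auto
  finally have 1: "- (?p b * ln (?p b)) \<le> (\<Sum>a\<in>B - {b}. t)" .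
  have 2: "- (?p a * ln (?p a)) \<le> 2 * sqrt t" if "a \<in> B - {b}" for a
  proof (cases "?p a = 0")
    case False
    \<comment> \<open>Applied to the probability itself, \<open>ln y \<le> y - 1\<close> only bounds
      the term by a number near 1. Applied to its square root, it gains the small factor
      \<open>u\<close>.\<close>
    define u where "u = sqrt (?p a)"
    have u: "0 < u" "?p a = u * u" using False by (auto simp: u_def zero_less_measure_iff)
    have "ln (1 / u) \<le> 1 / u - 1" using u by (intro ln_le_minus_one) simp
    then have "u * u * (2 * ln (1 / u)) \<le> u * u * (2 * (1 / u - 1))"
      using u by (intro mult_left_mono) auto
    moreover have "u * u * (2 * (1 / u - 1)) \<le> 2 * u" using u by (simp add: algebra_simps)
    moreover have "ln (?p a) = - 2 * ln (1 / u)" using u by (simp add: ln_mult ln_div)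
    ultimately have "- (?p a * ln (?p a)) \<le> 2 * u" using u(2) by simp
    also have "u \<le> sqrt t" unfolding u_def using small that by simp
    finally show ?thesis by simp
  qed (use t in simp)
  have "shannon_entropy X = - (?p b * ln (?p b)) + (\<Sum>a\<in>B - {b}. - (?p a * ln (?p a)))"
    using shannon_entropy_superset[OF B] sum.insert[of "B - {b}" b "\<lambda>a. ?p a * ln (?p a)"] fin
    by (simp add: sum_negf)
  also have "\<dots> \<le> (\<Sum>a\<in>B - {b}. t) + (\<Sum>a\<in>B - {b}. 2 * sqrt t)"
    using 1 2 by (intro add_mono sum_mono) auto
  also have "\<dots> = real (card (B - {b})) * (t + 2 * sqrt t)" by (simp add: algebra_simps)
  also have "\<dots> \<le> real (card B) * (t + 2 * sqrt t)"
    using t fin by (intro mult_right_mono) (auto intro: card_mono)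
  finally show ?thesis .
qed

end

section \<open>Itineraries and their entropy under an invariant measure\<close>

text \<open>Restriction to \<open>{..<n}\<close> makes the values for the atom map of
  \<open>P\<close> the very functions that index \<open>iterated_join\<close>.\<close>

definition itinerary :: "('a \<Rightarrow> 'a) \<Rightarrow> ('a \<Rightarrow> 'b) \<Rightarrow> nat \<Rightarrow> 'a \<Rightarrow> nat \<Rightarrow> 'b" where
  "itinerary f X n x = (\<lambda>i\<in>{..<n}. X ((f ^^ i) x))"

lemma itinerary_eq_iff:
  "itinerary f X n x = itinerary f X n y \<longleftrightarrow> (\<forall>i<n. X ((f ^^ i) x) = X ((f ^^ i) y))"
  by (auto simp: itinerary_def fun_eq_iff restrict_def)

lemma simple_function_measurable_comp:
  assumes f: "f \<in> measurable N M" and X: "simple_function M X"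
  shows "simple_function N (\<lambda>x. X (f x))"
proof -
  have "(\<lambda>x. X (f x)) ` space N \<subseteq> X ` space M" using measurable_space[OF f] by auto
  moreover have "(\<lambda>x. X (f x)) -` {a} \<inter> space N \<in> sets N" for a
  proof -
    have "(\<lambda>x. X (f x)) -` {a} \<inter> space N = f -` (X -` {a} \<inter> space M) \<inter> space N"
      using measurable_space[OF f] by auto
    then show ?thesis using measurable_sets[OF f simple_functionD(2)[OF X]] by simp
  qed
  ultimately show ?thesis
    using simple_functionD(1)[OF X] unfolding simple_function_def
    by (auto dest: finite_subset)
qed

lemma simple_function_itinerary:
  assumes f: "f \<in> measurable M M" and X: "simple_function M X"
  shows "simple_function M (itinerary f X n)"
proof (induction n)
  case 0
  show ?case by (simp add: itinerary_def)
next
  case (Suc n)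
  have "simple_function M (\<lambda>x. (itinerary f X n x, X ((f ^^ n) x)))"
    by (intro simple_function_Pair Suc simple_function_measurable_comp[OF measurable_compose_n[OF f] X])
  then show ?case
    by (rule simple_function_determined[of _ _ "itinerary f X (Suc n)"])
       (auto simp: itinerary_eq_iff less_Suc_eq)
qed

context prob_space
begin

lemma shannon_entropy_invariant:
  assumes inv: "invariant_measure M f" and X: "simple_function M X"
  shows "shannon_entropy (\<lambda>x. X (f x)) = shannon_entropy X"
proof -
  have f: "f \<in> measurable M M" using inv by (simp add: invariant_measure_def)
  \<comment> \<open>The map need not be onto, so the image can shrink; summing over the larger image
    adds only empty fibres.\<close>
  have img: "(\<lambda>x. X (f x)) ` space M \<subseteq> X ` space M" using measurable_space[OF f] by auto
  have "prob ((\<lambda>x. X (f x)) -` {a} \<inter> space M) = prob (X -` {a} \<inter> space M)" for a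
  proof -
    have "(\<lambda>x. X (f x)) -` {a} \<inter> space M = f -` (X -` {a} \<inter> space M) \<inter> space M"
      using measurable_space[OF f] by auto
    then show ?thesis
      using inv simple_functionD(2)[OF X, of "{a}"]
      by (simp add: invariant_measure_def measure_def del: vimage_Int)
  qed
  with shannon_entropy_superset[OF simple_functionD(1)[OF X] img] show ?thesis
    by (simp add: shannon_entropy_def)
qed

text \<open>The long itinerary is determined by its first \<open>m\<close> entries together with the
  length-\<open>n\<close> itinerary of \<open>(f ^^ m) x\<close>, and by invariance the latter has
  the entropy of the itinerary of \<open>x\<close>.\<close>

lemma shannon_entropy_itinerary_add_le:
  assumes inv: "invariant_measure M f" and X: "simple_function M X"
  shows "shannon_entropy (itinerary f X (m + n)) \<le>
    shannon_entropy (itinerary f X m) + shannon_entropy (itinerary f X n)"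
proof -
  have f: "f \<in> measurable M M" using inv by (simp add: invariant_measure_def)
  note simple = simple_function_itinerary[OF f X]
  have simple': "simple_function M (\<lambda>x. itinerary f X n ((f ^^ k) x))" for k
    by (intro simple_function_measurable_comp[OF measurable_compose_n[OF f] simple])
  have shift: "shannon_entropy (\<lambda>x. itinerary f X n ((f ^^ k) x)) = shannon_entropy (itinerary f X n)" for k
  proof (induction k)
    case (Suc k)
    have "shannon_entropy (\<lambda>x. itinerary f X n ((f ^^ k) (f x))) = shannon_entropy (\<lambda>x. itinerary f X n ((f ^^ k) x))"
      by (rule shannon_entropy_invariant[OF inv simple'])
    with Suc show ?case by (simp add: funpow_swap1)
  qed simp
  have "shannon_entropy (itinerary f X (m + n)) \<le>
      shannon_entropy (\<lambda>x. (itinerary f X m x, itinerary f X n ((f ^^ m) x)))"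
  proof (rule shannon_entropy_determined_le[OF simple_function_Pair[OF simple simple']])
    fix x y
    assume "(itinerary f X m x, itinerary f X n ((f ^^ m) x)) =
        (itinerary f X m y, itinerary f X n ((f ^^ m) y))"
    then have m: "\<forall>i<m. X ((f ^^ i) x) = X ((f ^^ i) y)"
      and n: "\<forall>i<n. X ((f ^^ (i + m)) x) = X ((f ^^ (i + m)) y)"
      by (auto simp: itinerary_eq_iff funpow_add)
    have "X ((f ^^ i) x) = X ((f ^^ i) y)" if "i < m + n" for i
    proof (cases "i < m")
      case False
      with that n[rule_format, of "i - m"] show ?thesis by simp
    qed (use m in simp)
    then show "itinerary f X (m + n) x = itinerary f X (m + n) y"
      by (simp add: itinerary_eq_iff)
  qed
  also have "\<dots> \<le> shannon_entropy (itinerary f X m) + shannon_entropy (itinerary f X n)"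
    using shannon_entropy_Pair_le[OF simple simple'] by (simp add: shift)
  finally show ?thesis .
qed

lemma shannon_entropy_itinerary_le:
  assumes inv: "invariant_measure M f" and X: "simple_function M X"
  shows "shannon_entropy (itinerary f X n) \<le> real n * shannon_entropy X"
proof (induction n)
  case 0
  have "shannon_entropy (itinerary f X 0) \<le> ln (real (card (itinerary f X 0 ` space M)))"
    using inv by (intro shannon_entropy_le_ln_card simple_function_itinerary[OF _ X])
      (simp add: invariant_measure_def)
  also have "itinerary f X 0 ` space M = {\<lambda>_. undefined}"
  proof -
    have "itinerary f X 0 = (\<lambda>_ _. undefined)" by (simp add: itinerary_def fun_eq_iff)
    then show ?thesis by (simp add: image_constant_conv not_empty)
  qed
  finally show ?case by simp
next
  case (Suc n)
  have "shannon_entropy (itinerary f X 1) \<le> shannon_entropy X"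
    by (rule shannon_entropy_determined_le[OF X]) (simp add: itinerary_eq_iff)
  with Suc shannon_entropy_itinerary_add_le[OF inv X, of n 1] show ?case
    by (simp add: algebra_simps)
qed

end

section \<open>From partitions to functions\<close>

definition partition_atom :: "'a set set \<Rightarrow> 'a \<Rightarrow> 'a set" where
  "partition_atom P x = (THE A. A \<in> P \<and> x \<in> A)"

lemma partition_atom_eq:
  assumes "partition_on S P" "A \<in> P" "x \<in> A"
  shows "partition_atom P x = A"
  unfolding partition_atom_def
proof (rule the_equality)
  show "B = A" if "B \<in> P \<and> x \<in> B" for B
    using that assms disjointD[OF partition_onD2[OF assms(1)], of A B] by blast
qed (use assms in simp)

lemma partition_atom_mem:
  assumes "partition_on S P" "x \<in> S"
  shows "partition_atom P x \<in> P" "x \<in> partition_atom P x"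
proof -
  obtain A where "A \<in> P" "x \<in> A" using assms by (auto dest: partition_onD1)
  with partition_atom_eq[OF assms(1)] show "partition_atom P x \<in> P" "x \<in> partition_atom P x" by auto
qed

lemma simple_function_partition_atom:
  assumes P: "finite_measurable_partition M P"
  shows "simple_function M (partition_atom P)"
proof -
  have part: "partition_on (space M) P" and fin: "finite P" and sets: "P \<subseteq> sets M"
    using P by (auto simp: finite_measurable_partition_def)
  have img: "partition_atom P ` space M \<subseteq> P" using partition_atom_mem[OF part] by auto
  have "partition_atom P -` {A} \<inter> space M = A" if "A \<in> P" for A
  proof -
    have "A \<subseteq> space M" using that sets sets.sets_into_space by blast
    then show ?thesis
      using that partition_atom_eq[OF part that] partition_atom_mem(2)[OF part] by blast
  qed
  then have "\<forall>A\<in>partition_atom P ` space M. partition_atom P -` {A} \<inter> space M \<in> sets M"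
    using img sets by (simp add: image_subset_iff subset_iff)
  with finite_subset[OF img fin] show ?thesis by (simp add: simple_function_def)
qed

text \<open>The cell indexed by \<open>C\<close> is the fibre of the itinerary over
  \<open>C\<close>, so the two sums agree up to empty cells.\<close>

lemma partition_entropy_iterated_join:
  assumes M: "prob_space M" and f: "f \<in> measurable M M" and P: "finite_measurable_partition M P"
  shows "partition_entropy M (iterated_join M f P n) =
    prob_space.shannon_entropy M (itinerary f (partition_atom P) n)"
proof -
  interpret prob_space M by fact
  have part: "partition_on (space M) P" and fin: "finite P"
    using P by (auto simp: finite_measurable_partition_def)
  let ?I = "itinerary f (partition_atom P) n"
  let ?A = "\<lambda>C. {x \<in> space M. \<forall>i<n. (f ^^ i) x \<in> C i}"
  let ?h = "\<lambda>A. prob A * ln (prob A)"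
  have f_space: "(f ^^ i) x \<in> space M" if "x \<in> space M" for i x
    using measurable_space[OF measurable_compose_n[OF f] that] .
  have img: "?I ` space M \<subseteq> {..<n} \<rightarrow>\<^sub>E P"
    using f_space partition_atom_mem[OF part] by (auto simp: itinerary_def)
  have A: "?A C = ?I -` {C} \<inter> space M" if C: "C \<in> {..<n} \<rightarrow>\<^sub>E P" for C
  proof -
    have "((f ^^ i) x \<in> C i) = (partition_atom P ((f ^^ i) x) = C i)" if "i < n" "x \<in> space M" for i x
      using that C partition_atom_eq[OF part, of "C i" "(f ^^ i) x"]
        partition_atom_mem[OF part f_space[OF that(2)]] by auto
    moreover have "?I x = C \<longleftrightarrow> (\<forall>i<n. partition_atom P ((f ^^ i) x) = C i)" for x
      using C by (auto simp: itinerary_def fun_eq_iff restrict_def PiE_def extensional_def)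
    ultimately show ?thesis unfolding vimage_def by blast
  qed
  have "partition_entropy M (iterated_join M f P n) = - (\<Sum>C\<in>{..<n} \<rightarrow>\<^sub>E P. ?h (?A C))"
    unfolding partition_entropy_def iterated_join_def
  proof (subst sum.reindex_nontrivial)
    show "finite ({..<n} \<rightarrow>\<^sub>E P)" using fin by (intro finite_PiE) auto
    fix C D assume CD: "C \<in> {..<n} \<rightarrow>\<^sub>E P" "D \<in> {..<n} \<rightarrow>\<^sub>E P" "C \<noteq> D" "?A C = ?A D"
    \<comment> \<open>Fibres over different values are disjoint, so two of them coincide only when
      both are empty.\<close>
    then have "?A C = {}" using A[of C] A[of D] by auto
    then show "?h (?A C) = 0" by (simp only: measure_empty mult_zero_left)
  qed simp
  also have "(\<Sum>C\<in>{..<n} \<rightarrow>\<^sub>E P. ?h (?A C)) = (\<Sum>C\<in>{..<n} \<rightarrow>\<^sub>E P. ?h (?I -` {C} \<inter> space M))"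
    by (intro sum.cong refl) (simp only: A)
  also have "- \<dots> = shannon_entropy ?I"
    by (rule shannon_entropy_superset[symmetric, OF _ img]) (use fin in \<open>auto intro: finite_PiE\<close>)
  finally show ?thesis .
qed

text \<open>Shows that the \<open>lim\<close> in the definition of the entropy is a genuine limit,
  which every later asymptotic estimate relies on.\<close>

lemma entropy_wrt_partition_LIMSEQ:
  assumes M: "prob_space M" and inv: "invariant_measure M f" and P: "finite_measurable_partition M P"
  shows "(\<lambda>n. prob_space.shannon_entropy M (itinerary f (partition_atom P) n) / real n)
    \<longlonglongrightarrow> entropy_wrt_partition M f P"
proof -
  interpret prob_space M by fact
  have f: "f \<in> measurable M M" using inv by (simp add: invariant_measure_def)
  have "convergent (\<lambda>n. shannon_entropy (itinerary f (partition_atom P) n) / real n)"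
    by (intro subadditive_converges shannon_entropy_nonneg
      shannon_entropy_itinerary_add_le[OF inv simple_function_partition_atom[OF P]])
  then show ?thesis
    unfolding entropy_wrt_partition_def partition_entropy_iterated_join[OF M f P]
    by (simp add: convergent_LIMSEQ_iff)
qed

section \<open>Bowen balls and partition entropy\<close>

lemma bowen_ball_eq_INT: "bowen_ball f x n r = (\<Inter>i\<le>n. (f ^^ i) -` ball ((f ^^ i) x) r)"
  by (auto simp: bowen_ball_def)

lemma open_bowen_ball:
  assumes "continuous_on UNIV f"
  shows "open (bowen_ball f x n r)"
proof -
  have "continuous_on UNIV (f ^^ i)" for i
  proof (induction i)
    case (Suc i)
    have "continuous_on UNIV (f \<circ> f ^^ i)"
      by (rule continuous_on_compose[OF Suc continuous_on_subset[OF assms subset_UNIV]])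
    then show ?case by (simp only: funpow.simps)
  qed (simp add: id_def)
  then show ?thesis unfolding bowen_ball_eq_INT
    by (intro open_INT ballI open_vimage) auto
qed

lemma bowen_ball_center: "0 < r \<Longrightarrow> x \<in> bowen_ball f x n r"
  by (simp add: bowen_ball_def)

lemma dist_less_of_bowen_ball:
  assumes "z \<in> bowen_ball f x n r" "z \<in> bowen_ball f y n s" "i \<le> n"
  shows "dist ((f ^^ i) x) ((f ^^ i) y) < r + s"
proof -
  have "dist ((f ^^ i) x) ((f ^^ i) z) < r" "dist ((f ^^ i) y) ((f ^^ i) z) < s"
    using assms by (auto simp: bowen_ball_def)
  then show ?thesis using dist_triangle2[of "(f ^^ i) x" "(f ^^ i) y" "(f ^^ i) z"] by linarith
qed

section \<open>Covers and packings\<close>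

text \<open>A measurable choice of a covering set: enumerate \<open>F\<close> and take the first
  member that contains the point.\<close>

lemma finite_cover_simple_function:
  assumes fin: "finite F" and B: "\<And>z. z \<in> F \<Longrightarrow> B z \<in> sets M"
    and cover: "\<And>x. x \<in> space M \<Longrightarrow> \<exists>z\<in>F. x \<in> B z"
  obtains e where "simple_function M e" "e ` space M \<subseteq> F" "\<And>x. x \<in> space M \<Longrightarrow> x \<in> B (e x)"
proof -
  obtain h where h: "bij_betw h {..<card F} F"
    using ex_bij_betw_nat_finite[OF fin] by (auto simp: atLeast0LessThan)
  define g where "g x = (LEAST i. i < card F \<and> x \<in> B (h i))" for x
  have hF: "h i \<in> F" if "i < card F" for i using h that by (auto simp: bij_betw_def)
  have g: "g x < card F \<and> x \<in> B (h (g x))" if x: "x \<in> space M" for x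
  proof -
    obtain z where "z \<in> F" "x \<in> B z" using cover[OF x] by blast
    moreover obtain i where "i < card F" "h i = z"
      using h \<open>z \<in> F\<close> unfolding bij_betw_def by (metis imageE lessThan_iff)
    ultimately have "i < card F \<and> x \<in> B (h i)" by simp
    then show ?thesis unfolding g_def by (rule LeastI)
  qed
  have "g \<in> measurable M (count_space UNIV)"
    unfolding g_def
  proof (rule measurable_Least)
    fix i
    have "{x \<in> space M. i < card F \<and> x \<in> B (h i)} = (if i < card F then B (h i) else {})"
      using B[OF hF] sets.sets_into_space by auto
    then show "Measurable.pred M (\<lambda>x. i < card F \<and> x \<in> B (h i))"
      using B[OF hF] unfolding pred_def by simp
  qed
  moreover have "finite (g ` space M)"
    by (rule finite_subset[of _ "{..<card F}"]) (use g in auto)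
  ultimately have "simple_function M g"
    by (auto simp: simple_function_def intro: measurable_sets)
  then have "simple_function M (h \<circ> g)" by (rule simple_function_compose)
  then show thesis
    by (rule that) (use g hF in auto)
qed

text \<open>Disjoint families are maximised by cardinality, so the bound \<open>1 / m\<close> itself
  yields a maximal one.\<close>

lemma (in prob_space) finite_intersecting_family:
  assumes B: "\<And>x. B x \<in> events" and ge: "\<And>x. m \<le> prob (B x)" and m: "0 < m"
  obtains F where "finite F" "real (card F) \<le> 1 / m" "\<And>y. \<exists>x\<in>F. B x \<inter> B y \<noteq> {}"
proof -
  define S where "S = {F. finite F \<and> disjoint_family_on B F}"
  have bound: "real (card F) \<le> 1 / m" if "F \<in> S" for F
  proof -
    have "real (card F) * m = (\<Sum>x\<in>F. m)" by simp
    also have "\<dots> \<le> (\<Sum>x\<in>F. prob (B x))" by (intro sum_mono ge)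
    also have "\<dots> = prob (\<Union>x\<in>F. B x)"
      using that B by (intro finite_measure_finite_Union[symmetric]) (auto simp: S_def)
    also have "\<dots> \<le> 1" by simp
    finally show ?thesis using m by (simp add: field_simps)
  qed
  have "{} \<in> S" by (simp add: S_def disjoint_family_on_def)
  moreover have "\<forall>F. F \<in> S \<longrightarrow> card F < Suc (nat \<lfloor>1 / m\<rfloor>)"
    using bound by (auto simp: less_Suc_eq_le le_nat_floor)
  ultimately obtain F where F: "F \<in> S" "\<forall>G. G \<in> S \<longrightarrow> card G \<le> card F"
    using ex_has_greatest_nat[of "\<lambda>F. F \<in> S" "{}" card "Suc (nat \<lfloor>1 / m\<rfloor>)"] by blast
  have "\<exists>x\<in>F. B x \<inter> B y \<noteq> {}" for y
  proof (rule ccontr)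
    assume no: "\<not> (\<exists>x\<in>F. B x \<inter> B y \<noteq> {})"
    \<comment> \<open>Were \<open>y\<close> in \<open>F\<close>, then \<open>B y\<close> would meet
      itself; hence \<open>y\<close> is a new index and the enlarged family contradicts
      maximality.\<close>
    have "B y \<noteq> {}" using ge[of y] m by auto
    with no have "y \<notin> F" by auto
    moreover have "insert y F \<in> S"
      using F(1) no by (auto simp: S_def disjoint_family_on_def)
    ultimately show False using F by (auto simp: S_def)
  qed
  with F bound show thesis by (intro that[of F]) (auto simp: S_def)
qed

text \<open>The partition depends on \<open>d\<close> alone and serves all \<open>n\<close> at once.
  The length is \<open>Suc n\<close> because Bowen balls include time \<open>n\<close>: two points
  with equal itineraries of that length stay within \<open>d\<close> up to time
  \<open>n\<close>.\<close>

lemma entropy_ge_of_bowen_balls: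
  fixes f :: "'a::metric_space \<Rightarrow> 'a"
  assumes cpt: "compact (UNIV :: 'a set)" and sets: "sets M = sets borel"
    and M: "prob_space M" and f: "f \<in> measurable M M" and d: "0 < d"
  obtains P where "finite_measurable_partition M P"
    "\<And>n p. (\<And>x. measure M (bowen_ball f x n d) \<le> p) \<Longrightarrow> (\<And>x. bowen_ball f x n d \<in> sets M) \<Longrightarrow>
      - ln p \<le> prob_space.shannon_entropy M (itinerary f (partition_atom P) (Suc n))"
proof -
  interpret prob_space M by fact
  have space: "space M = UNIV" using sets_eq_imp_space_eq[OF sets] by simp
  have "UNIV \<subseteq> (\<Union>z\<in>(UNIV :: 'a set). ball z (d / 2))"
  proof
    fix x :: 'a
    have "x \<in> ball x (d / 2)" using d by simp
    then show "x \<in> (\<Union>z\<in>UNIV. ball z (d / 2))" by blast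
  qed
  from compactE_image[OF cpt open_ball this]
  obtain F where F: "finite F" "(UNIV :: 'a set) \<subseteq> (\<Union>z\<in>F. ball z (d / 2))"
    by metis
  have cover: "\<exists>z\<in>F. x \<in> ball z (d / 2)" for x using F(2) by (simp add: subset_iff)
  have "ball z (d / 2) \<in> sets M" for z by (simp add: sets)
  from finite_cover_simple_function[of F "\<lambda>z. ball z (d / 2)" M, OF F(1) this cover]
  obtain e where e: "simple_function M e" "e ` space M \<subseteq> F"
    "\<And>x. x \<in> space M \<Longrightarrow> x \<in> ball (e x) (d / 2)"
    by metis
  \<comment> \<open>Only values attained by \<open>e\<close> are used, since a partition may not
    contain the empty set.\<close>
  define P where "P = (\<lambda>z. e -` {z} \<inter> space M) ` e ` space M"
  have part: "partition_on (space M) P"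
    unfolding P_def by (rule partition_onI) (auto simp: disjnt_def)
  have P: "finite_measurable_partition M P"
    using part e simple_functionD[OF e(1)] by (auto simp: finite_measurable_partition_def P_def)
  have diam: "dist x y < d" if "partition_atom P x = partition_atom P y" for x y
  proof -
    have "y \<in> partition_atom P x" "x \<in> partition_atom P x" "partition_atom P x \<in> P"
      using partition_atom_mem[OF part, of x] partition_atom_mem[OF part, of y] that by (auto simp: space)
    then have "e x = e y" by (auto simp: P_def)
    moreover have "dist (e x) x < d / 2" "dist (e y) y < d / 2" using e(3) by (auto simp: space)
    ultimately show ?thesis using dist_triangle3[of x y "e x"] by simp
  qed
  show thesis
  proof (rule that[OF P])
    fix n p
    assume le: "\<And>x. measure M (bowen_ball f x n d) \<le> p" and meas: "\<And>x. bowen_ball f x n d \<in> sets M"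
    show "- ln p \<le> shannon_entropy (itinerary f (partition_atom P) (Suc n))"
    proof (rule shannon_entropy_ge_minus_ln)
      show "simple_function M (itinerary f (partition_atom P) (Suc n))"
        by (intro simple_function_itinerary f simple_function_partition_atom P)
      fix a
      show "prob (itinerary f (partition_atom P) (Suc n) -` {a} \<inter> space M) \<le> p"
      proof (cases "\<exists>x. itinerary f (partition_atom P) (Suc n) x = a")
        case True
        then obtain x where x: "itinerary f (partition_atom P) (Suc n) x = a" by blast
        have "itinerary f (partition_atom P) (Suc n) -` {a} \<inter> space M \<subseteq> bowen_ball f x n d"
        proof
          fix y assume "y \<in> itinerary f (partition_atom P) (Suc n) -` {a} \<inter> space M"
          then have "itinerary f (partition_atom P) (Suc n) x = itinerary f (partition_atom P) (Suc n) y"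
            using x by simp
          then show "y \<in> bowen_ball f x n d"
            unfolding itinerary_eq_iff bowen_ball_def using diam by (simp add: less_Suc_eq_le)
        qed
        then show ?thesis
          using finite_measure_mono[OF _ meas] le[of x] by (meson order_trans)
      next
        case False
        then have "itinerary f (partition_atom P) (Suc n) -` {a} \<inter> space M = {}" by auto
        then show ?thesis using le[of undefined] measure_nonneg[of M] order_trans by (metis measure_empty)
      qed
    qed
  qed
qed

text \<open>Shrink each atom \<open>A\<close> to a closed \<open>C A\<close>. The variable \<open>R\<close> below records the atom of a point
  only outside the shrunken atoms, so it has small entropy. A point that stays near a known orbit
  has its remaining itinerary forced by the positive distance between the compact sets \<open>C A\<close>.
  Hence the number of Bowen balls needed to cover the space bounds the entropy with no extra
  factor \<open>2 ^ n\<close> for boundary effects.\<close>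

lemma entropy_le_of_bowen_balls:
  fixes f :: "'a::metric_space \<Rightarrow> 'a"
  assumes cpt: "compact (UNIV :: 'a set)" and cont: "continuous_on UNIV f"
    and sets: "sets M = sets borel"
    and M: "prob_space M" and inv: "invariant_measure M f"
    and P: "finite_measurable_partition M P" and \<eta>: "0 < \<eta>"
  obtains r where "0 < r"
    "\<And>n m. 0 < m \<Longrightarrow> (\<And>x. m \<le> measure M (bowen_ball f x n r)) \<Longrightarrow>
      prob_space.shannon_entropy M (itinerary f (partition_atom P) n) \<le> - ln m + real n * \<eta>"
proof -
  interpret prob_space M by fact
  have f: "f \<in> measurable M M" using inv by (simp add: invariant_measure_def)
  have space: "space M = UNIV" using sets_eq_imp_space_eq[OF sets] by simp
  have part: "partition_on (space M) P" and finP: "finite P" and setsP: "P \<subseteq> sets M"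
    using P by (auto simp: finite_measurable_partition_def)
  note atom_mem = partition_atom_mem[OF part, unfolded space, OF UNIV_I]
  note atom_eq = partition_atom_eq[OF part]
  \<comment> \<open>With \<open>t = u\<^sup>2\<close> the bound of
    \<open>shannon_entropy_le_of_dominant_value\<close> is at most \<open>card P * 3 * u\<close>;
    \<open>u \<le> 1\<close> gives \<open>t \<le> u\<close>, and the summand 1 keeps the denominator
    positive.\<close>
  define u where "u = min 1 (\<eta> / (3 * real (card P) + 1))"
  define t where "t = u\<^sup>2"
  have u: "0 < u" "u \<le> 1" "u * (3 * real (card P) + 1) \<le> \<eta>"
  proof -
    show "0 < u" "u \<le> 1" using \<eta> by (auto simp: u_def)
    have "u \<le> \<eta> / (3 * real (card P) + 1)" by (simp add: u_def)
    then show "u * (3 * real (card P) + 1) \<le> \<eta>" by (simp add: field_simps)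
  qed
  have t: "0 < t" "real (card P) * (t + 2 * sqrt t) \<le> \<eta>"
  proof -
    show "0 < t" using u by (simp add: t_def)
    have "sqrt t = u" "t \<le> u" using u by (auto simp: t_def power2_eq_square mult_left_le)
    then have "real (card P) * (t + 2 * sqrt t) \<le> real (card P) * (3 * u)"
      by (intro mult_left_mono) auto
    also have "\<dots> \<le> \<eta>" using u by (simp add: algebra_simps)
    finally show "real (card P) * (t + 2 * sqrt t) \<le> \<eta>" .
  qed
  have "\<exists>C. closed C \<and> C \<subseteq> A \<and> measure M (A - C) < t" if "A \<in> P" for A
  proof -
    have "A \<in> sets borel" using that setsP sets by auto
    then show ?thesis
      using closed_inner_regular[OF finite_measure_axioms sets _ t(1)] by metis
  qed
  then obtain C where C: "\<And>A. A \<in> P \<Longrightarrow> closed (C A)" "\<And>A. A \<in> P \<Longrightarrow> C A \<subseteq> A"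
    "\<And>A. A \<in> P \<Longrightarrow> measure M (A - C A) < t" by metis
  have "compact (C A)" if "A \<in> P" for A
    using compact_Int_closed[OF cpt C(1)[OF that]] by simp
  moreover have "C A \<inter> C B = {}" if "A \<in> P" "B \<in> P" "A \<noteq> B" for A B
    using C(2) that disjointD[OF partition_onD2[OF part], of A B] by blast
  ultimately obtain r' where r': "0 < r'"
    "\<And>A B x y. A \<in> P \<Longrightarrow> B \<in> P \<Longrightarrow> x \<in> C A \<Longrightarrow> y \<in> C B \<Longrightarrow> dist x y < r' \<Longrightarrow> A = B"
    using disjoint_compacts_separated[OF finP, of C] by metis
  let ?\<alpha> = "partition_atom P"
  \<comment> \<open>\<open>None\<close> is the dominant value, since the shrunken atoms carry almost
    all the mass.\<close>
  define R where "R x = (if x \<in> C (?\<alpha> x) then None else Some (?\<alpha> x))" for x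
  define U where "U = (\<Union>A\<in>P. C A)"
  have U: "U \<in> sets M" unfolding U_def using finP C(1) by (intro sets.finite_UN) (auto simp: sets)
  have U_iff: "x \<in> C (?\<alpha> x) \<longleftrightarrow> x \<in> U" for x
    using atom_mem C(2) atom_eq unfolding U_def by blast
  have R: "simple_function M R"
  proof (rule simple_function_determined[of M "\<lambda>x. (indicator U x :: real, ?\<alpha> x)" R])
    show "simple_function M (\<lambda>x. (indicator U x :: real, ?\<alpha> x))"
      by (intro simple_function_Pair simple_function_indicator U simple_function_partition_atom P)
    show "R x = R y" if "(indicator U x :: real, ?\<alpha> x) = (indicator U y, ?\<alpha> y)" for x y
      using that unfolding R_def U_iff by (auto simp: indicator_def split: if_splits)
  qed
  have R_small: "prob (R -` {b} \<inter> space M) \<le> t" if b: "b \<in> Some ` P" for b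
  proof -
    obtain A where A: "A \<in> P" "b = Some A" using b by blast
    have "R -` {b} \<inter> space M \<subseteq> A - C A"
      using A atom_mem by (auto simp: R_def split: if_splits)
    then have "prob (R -` {b} \<inter> space M) \<le> prob (A - C A)"
      using A setsP C(1) by (intro finite_measure_mono) (auto simp: sets)
    with C(3)[OF A(1)] show ?thesis by linarith
  qed
  have "shannon_entropy R \<le> real (card (Some ` P)) * (t + 2 * sqrt t)"
    by (rule shannon_entropy_le_of_dominant_value[where b = None, OF _ _ R_small R])
       (use finP atom_mem t(1) in \<open>auto simp: R_def\<close>)
  also have "\<dots> \<le> \<eta>" using t(2) by (simp add: card_image)
  finally have HR: "shannon_entropy R \<le> \<eta>" .
  \<comment> \<open>The radius doubles twice: intersecting balls of radius \<open>r' / 4\<close>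
    give a cover by balls of radius \<open>r' / 2\<close>, and two points of one such ball stay less
    than \<open>r'\<close> apart.\<close>
  have main: "shannon_entropy (itinerary f ?\<alpha> n) \<le> - ln m + real n * \<eta>"
    if m: "0 < m" and ge: "\<And>x. m \<le> measure M (bowen_ball f x n (r' / 4))" for n m
  proof -
    have meas: "bowen_ball f x n r \<in> sets M" for x r
      using open_bowen_ball[OF cont] by (simp add: sets)
    obtain F where F: "finite F" "real (card F) \<le> 1 / m"
      "\<And>y. \<exists>x\<in>F. bowen_ball f x n (r' / 4) \<inter> bowen_ball f y n (r' / 4) \<noteq> {}"
      using finite_intersecting_family[of "\<lambda>x. bowen_ball f x n (r' / 4)" m] meas ge m by metis
    have cover: "\<exists>z\<in>F. x \<in> bowen_ball f z n (r' / 2)" for x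
    proof -
      obtain z w where "z \<in> F" "w \<in> bowen_ball f z n (r' / 4)" "w \<in> bowen_ball f x n (r' / 4)"
        using F(3)[of x] by blast
      then show ?thesis
        using dist_less_of_bowen_ball[of w f z n "r' / 4" x "r' / 4"] by (auto simp: bowen_ball_def)
    qed
    obtain e where e: "simple_function M e" "e ` space M \<subseteq> F"
      "\<And>x. x \<in> space M \<Longrightarrow> x \<in> bowen_ball f (e x) n (r' / 2)"
      using finite_cover_simple_function[of F "\<lambda>x. bowen_ball f x n (r' / 2)" M] F(1) meas cover
      by metis
    have eR: "simple_function M (itinerary f R n)" by (rule simple_function_itinerary[OF f R])
    have "shannon_entropy (itinerary f ?\<alpha> n) \<le> shannon_entropy (\<lambda>x. (e x, itinerary f R n x))"
    proof (rule shannon_entropy_determined_le[OF simple_function_Pair[OF e(1) eR]])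
      fix x y assume "(e x, itinerary f R n x) = (e y, itinerary f R n y)"
      then have exy: "e x = e y" and Rxy: "\<And>i. i < n \<Longrightarrow> R ((f ^^ i) x) = R ((f ^^ i) y)"
        by (auto simp: itinerary_eq_iff)
      have "?\<alpha> ((f ^^ i) x) = ?\<alpha> ((f ^^ i) y)" if i: "i < n" for i
      proof (cases "R ((f ^^ i) x)")
        case None
        then have "(f ^^ i) x \<in> C (?\<alpha> ((f ^^ i) x))" "(f ^^ i) y \<in> C (?\<alpha> ((f ^^ i) y))"
          using Rxy[OF i] by (auto simp: R_def split: if_splits)
        moreover have "dist ((f ^^ i) (e x)) ((f ^^ i) x) < r' / 2"
          "dist ((f ^^ i) (e x)) ((f ^^ i) y) < r' / 2"
          using e(3)[of x] e(3)[of y] exy i by (auto simp: space bowen_ball_def)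
        then have "dist ((f ^^ i) x) ((f ^^ i) y) < r'"
          using dist_triangle3[of "(f ^^ i) x" "(f ^^ i) y" "(f ^^ i) (e x)"] by linarith
        ultimately show ?thesis using r'(2) atom_mem(1) by blast
      next
        case (Some A)
        then show ?thesis using Rxy[OF i] by (auto simp: R_def split: if_splits)
      qed
      then show "itinerary f ?\<alpha> n x = itinerary f ?\<alpha> n y" by (simp add: itinerary_eq_iff)
    qed
    also have "\<dots> \<le> shannon_entropy e + shannon_entropy (itinerary f R n)"
      by (rule shannon_entropy_Pair_le[OF e(1) eR])
    also have "shannon_entropy e \<le> - ln m"
    proof -
      have "0 < card (e ` space M)" using simple_functionD(1)[OF e(1)] not_empty by (auto simp: card_gt_0_iff)
      moreover have "real (card (e ` space M)) \<le> 1 / m" using card_mono[OF F(1) e(2)] F(2) by linarith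
      ultimately have "ln (real (card (e ` space M))) \<le> ln (1 / m)"
        by (intro ln_mono) auto
      with shannon_entropy_le_ln_card[OF e(1)] m show ?thesis by (simp add: ln_div)
    qed
    also have "shannon_entropy (itinerary f R n) \<le> real n * \<eta>"
      using shannon_entropy_itinerary_le[OF inv R, of n] mult_left_mono[OF HR, of "real n"] by simp
    finally show ?thesis by simp
  qed
  with r'(1) show thesis by (intro that[of "r' / 4"]) auto
qed

section \<open>Energy integrals and scales\<close>

text \<open>The function is lower semicontinuous: a slightly smaller ball around \<open>x\<close>
  has nearly the full measure and lies in the \<open>\<epsilon>\<close>-ball around every nearby
  \<open>y\<close>.\<close>

lemma borel_measurable_measure_ball:
  fixes M :: "'a::metric_space measure"
  assumes fin: "finite_measure M" and sets: "sets M = sets borel"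
  shows "(\<lambda>x. measure M (ball x \<epsilon>)) \<in> borel_measurable M"
proof -
  interpret finite_measure M by fact
  have "open {x. a < measure M (ball x \<epsilon>)}" for a
  proof (subst open_subopen, rule ballI)
    fix x assume "x \<in> {x. a < measure M (ball x \<epsilon>)}"
    then have a: "a < measure M (ball x \<epsilon>)" by simp
    define B where "B k = ball x (\<epsilon> - 1 / real (Suc k))" for k
    have "incseq B"
    proof (rule incseq_SucI)
      show "B k \<subseteq> B (Suc k)" for k
        unfolding B_def by (intro subset_ball) (simp add: field_simps)
    qed
    moreover have "(\<Union>k. B k) = ball x \<epsilon>"
    proof
      show "ball x \<epsilon> \<subseteq> (\<Union>k. B k)"
      proof
        fix y assume "y \<in> ball x \<epsilon>"
        then obtain k where "inverse (real (Suc k)) < \<epsilon> - dist x y"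
          using reals_Archimedean[of "\<epsilon> - dist x y"] by auto
        then show "y \<in> (\<Union>k. B k)" by (auto simp: B_def field_simps intro!: exI[of _ k])
      qed
      have "B k \<subseteq> ball x \<epsilon>" for k unfolding B_def by (intro subset_ball) simp
      then show "(\<Union>k. B k) \<subseteq> ball x \<epsilon>" by blast
    qed
    ultimately have "(\<lambda>k. measure M (B k)) \<longlonglongrightarrow> measure M (ball x \<epsilon>)"
      using finite_Lim_measure_incseq[of B] by (simp add: B_def sets image_subset_iff)
    then have "eventually (\<lambda>k. a < measure M (B k)) sequentially"
      using a by (rule order_tendstoD)
    then obtain k where k: "a < measure M (B k)"
      using eventually_happens'[OF sequentially_bot] by blast
    have "a < measure M (ball y \<epsilon>)" if "y \<in> ball x (1 / real (Suc k))" for y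
    proof -
      have "B k \<subseteq> ball y \<epsilon>"
      proof
        fix z assume "z \<in> B k"
        then have "dist x z < \<epsilon> - 1 / real (Suc k)" by (simp add: B_def)
        moreover have "dist x y < 1 / real (Suc k)" using that by simp
        ultimately show "z \<in> ball y \<epsilon>"
          using dist_triangle3[of y z x] unfolding mem_ball by linarith
      qed
      then have "measure M (B k) \<le> measure M (ball y \<epsilon>)"
        by (intro finite_measure_mono) (auto simp: sets)
      with k show ?thesis by linarith
    qed
    then show "\<exists>T. open T \<and> x \<in> T \<and> T \<subseteq> {x. a < measure M (ball x \<epsilon>)}"
      by (intro exI[of _ "ball x (1 / real (Suc k))"]) auto
  qed
  moreover have "space M = UNIV" using sets_eq_imp_space_eq[OF sets] by simp
  ultimately show ?thesis
    unfolding borel_measurable_iff_greater by (simp add: sets)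
qed

lemma (in prob_space) Jensen_ln_integral_exp:
  assumes g: "integrable M g" and exp: "integrable M (\<lambda>x. exp (g x) :: real)"
  shows "0 < (\<integral>x. exp (g x) \<partial>M)" "(\<integral>x. g x \<partial>M) \<le> ln (\<integral>x. exp (g x) \<partial>M)"
proof -
  have le: "exp (\<integral>x. g x \<partial>M) \<le> (\<integral>x. exp (g x) \<partial>M)"
    using jensens_inequality[where X = g and I = UNIV and q = exp] g exp exp_convex by simp
  then show pos: "0 < (\<integral>x. exp (g x) \<partial>M)" using exp_gt_zero less_le_trans by blast
  show "(\<integral>x. g x \<partial>M) \<le> ln (\<integral>x. exp (g x) \<partial>M)" using le pos by (simp add: ln_ge_iff)
qed

section \<open>Energy integrals at a fixed scale\<close>

text \<open>The uniform bound \<open>m\<close> makes \<open>ln\<close> of the ball measures bounded,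
  hence all integrands integrable for every real exponent.\<close>

locale positive_balls = prob_space M for M :: "'a::metric_space measure" +
  fixes \<epsilon> m :: real
  assumes sets_borel: "sets M = sets borel"
    and support: "measure_support M = UNIV"
    and \<epsilon>: "0 < \<epsilon>" "\<epsilon> < 1"
    and m: "0 < m" "\<And>x. m \<le> measure M (ball x \<epsilon>)"
begin

lemma ball_pos: "0 < measure M (ball x \<epsilon>)"
  using m by (meson less_le_trans)

lemma ln_ball_measurable[measurable]: "(\<lambda>x. ln (measure M (ball x \<epsilon>))) \<in> borel_measurable M"
  using borel_measurable_measure_ball[OF finite_measure_axioms sets_borel] by measurable

lemma abs_ln_ball_le: "\<bar>ln (measure M (ball x \<epsilon>))\<bar> \<le> - ln m"
proof -
  have "ln m \<le> ln (measure M (ball x \<epsilon>))" using m ball_pos by (intro ln_mono) auto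
  moreover have "ln (measure M (ball x \<epsilon>)) \<le> 0" using ball_pos by (simp add: ln_le_zero_iff)
  ultimately show ?thesis by simp
qed

lemma integrable_ln_ball: "integrable M (\<lambda>x. k * ln (measure M (ball x \<epsilon>)))"
  by (rule integrable_mult_right, rule integrable_const_bound[where B = "- ln m"])
     (use abs_ln_ball_le in auto)

lemma integrable_exp_ln_ball: "integrable M (\<lambda>x. exp (k * ln (measure M (ball x \<epsilon>))))"
proof (rule integrable_const_bound[where B = "exp (\<bar>k\<bar> * (- ln m))"])
  have "k * ln (measure M (ball x \<epsilon>)) \<le> \<bar>k\<bar> * (- ln m)" for x
  proof -
    have "k * ln (measure M (ball x \<epsilon>)) \<le> \<bar>k\<bar> * \<bar>ln (measure M (ball x \<epsilon>))\<bar>"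
      by (metis abs_ge_self abs_mult)
    also have "\<dots> \<le> \<bar>k\<bar> * (- ln m)" using abs_ln_ball_le by (intro mult_left_mono) auto
    finally show ?thesis .
  qed
  then show "AE x in M. norm (exp (k * ln (measure M (ball x \<epsilon>)))) \<le> exp (\<bar>k\<bar> * (- ln m))" by simp
qed measurable

lemma energy_integral_eq:
  "energy_integral M q \<epsilon> = (\<integral>x. exp ((q - 1) * ln (measure M (ball x \<epsilon>))) \<partial>M)"
  using ball_pos by (simp add: energy_integral_def set_lebesgue_integral_def support powr_def less_imp_neq[symmetric])

lemma energy_integral_pos: "0 < energy_integral M q \<epsilon>"
  unfolding energy_integral_eq
  by (rule Jensen_ln_integral_exp(1)[OF integrable_ln_ball integrable_exp_ln_ball])

lemma Jensen_energy_integral: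
  "(q - 1) * (\<integral>x. ln (measure M (ball x \<epsilon>)) \<partial>M) \<le> ln (energy_integral M q \<epsilon>)"
  using Jensen_ln_integral_exp(2)[OF integrable_ln_ball[of "q - 1"] integrable_exp_ln_ball]
  by (simp add: energy_integral_eq)

text \<open>Keeping the factor \<open>q - 1\<close> in the hypothesis lets \<open>b\<close> be an
  upper bound when \<open>q > 1\<close> and a lower bound when \<open>q < 1\<close>.\<close>

lemma ln_energy_integral_le:
  assumes "\<And>x. (q - 1) * ln (measure M (ball x \<epsilon>)) \<le> (q - 1) * b"
  shows "ln (energy_integral M q \<epsilon>) \<le> (q - 1) * b"
proof -
  have "energy_integral M q \<epsilon> \<le> (\<integral>x. exp ((q - 1) * b) \<partial>M)"
    unfolding energy_integral_eq
    by (rule integral_mono[OF integrable_exp_ln_ball]) (use assms in auto)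
  also have "\<dots> = exp ((q - 1) * b)" by (simp add: prob_space)
  finally have "energy_integral M q \<epsilon> \<le> exp ((q - 1) * b)" .
  then have "ln (energy_integral M q \<epsilon>) \<le> ln (exp ((q - 1) * b))"
    by (intro ln_mono energy_integral_pos) auto
  then show ?thesis by simp
qed

lemma dimension_quotient_1:
  "dimension_quotient M 1 \<epsilon> = (\<integral>x. ln (measure M (ball x \<epsilon>)) \<partial>M) / ln \<epsilon>"
  by (simp add: dimension_quotient_def set_lebesgue_integral_def support)

lemma ln_\<epsilon>_neg: "ln \<epsilon> < 0"
  using \<epsilon> by simp

text \<open>Jensen points the same way for all exponents, but the divisor
  \<open>(q - 1) * ln \<epsilon>\<close> is negative for \<open>q > 1\<close> and positive below 1,
  which puts the quotient at 1 between the other two.\<close>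

lemma dimension_quotient_le_1:
  assumes "1 < q"
  shows "dimension_quotient M q \<epsilon> \<le> dimension_quotient M 1 \<epsilon>"
  unfolding dimension_quotient_1
  using Jensen_energy_integral[of q] ln_\<epsilon>_neg assms
  by (simp add: dimension_quotient_def divide_simps mult.commute mult_neg_pos mult_less_0_iff)

lemma dimension_quotient_ge_1:
  assumes "s < 1"
  shows "dimension_quotient M 1 \<epsilon> \<le> dimension_quotient M s \<epsilon>"
  unfolding dimension_quotient_1
  using Jensen_energy_integral[of s] ln_\<epsilon>_neg assms
  by (simp add: dimension_quotient_def divide_simps mult.commute mult_neg_neg mult_less_0_iff)

lemma dimension_quotient_ge:
  assumes "1 < q" and "\<And>x. ln (measure M (ball x \<epsilon>)) \<le> b"
  shows "b / ln \<epsilon> \<le> dimension_quotient M q \<epsilon>"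
proof -
  have "(q - 1) * ln \<epsilon> < 0" using assms(1) ln_\<epsilon>_neg by (simp add: mult_pos_neg)
  moreover have "ln (energy_integral M q \<epsilon>) \<le> (q - 1) * b"
    using assms by (intro ln_energy_integral_le mult_left_mono) auto
  ultimately have "(q - 1) * b / ((q - 1) * ln \<epsilon>) \<le> ln (energy_integral M q \<epsilon>) / ((q - 1) * ln \<epsilon>)"
    by (intro divide_right_mono_neg) auto
  then show ?thesis using assms(1) by (simp add: dimension_quotient_def)
qed

lemma dimension_quotient_le:
  assumes "s < 1" and "\<And>x. b \<le> ln (measure M (ball x \<epsilon>))"
  shows "dimension_quotient M s \<epsilon> \<le> b / ln \<epsilon>"
proof -
  have "0 < (s - 1) * ln \<epsilon>" using assms(1) ln_\<epsilon>_neg by (simp add: mult_neg_neg)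
  moreover have "ln (energy_integral M s \<epsilon>) \<le> (s - 1) * b"
    using assms by (intro ln_energy_integral_le mult_left_mono_neg) auto
  ultimately have "ln (energy_integral M s \<epsilon>) / ((s - 1) * ln \<epsilon>) \<le> (s - 1) * b / ((s - 1) * ln \<epsilon>)"
    by (intro divide_right_mono) auto
  then show ?thesis using assms(1) by (simp add: dimension_quotient_def)
qed

end

section \<open>Nesting of balls and choice of the time index\<close>

text \<open>The Lipschitz bound is local, so the induction must know that the orbits are still
  within \<open>\<delta>\<close>; the estimate at the final time \<open>n\<close> dominates all
  earlier ones and guarantees this.\<close>

lemma ball_subset_bowen_ball:
  assumes exp: "\<And>x y. dist x y < \<delta> \<Longrightarrow> dist (f x) (f y) \<le> L * dist x y"
    and L: "1 \<le> L" and d: "d \<le> \<delta>" and \<epsilon>: "L ^ n * \<epsilon> \<le> d"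
  shows "ball x \<epsilon> \<subseteq> bowen_ball f x n d"
proof
  fix y assume "y \<in> ball x \<epsilon>"
  then have xy: "dist x y < \<epsilon>" by simp
  then have "0 \<le> \<epsilon>" using zero_le_dist[of x y] by linarith
  have less: "L ^ i * dist x y < d" if "i \<le> n" for i
  proof -
    have "L ^ i * dist x y < L ^ i * \<epsilon>" using xy L by simp
    also have "\<dots> \<le> L ^ n * \<epsilon>" using that L \<open>0 \<le> \<epsilon>\<close> by (intro mult_right_mono power_increasing) auto
    finally show ?thesis using \<epsilon> by linarith
  qed
  have le: "dist ((f ^^ i) x) ((f ^^ i) y) \<le> L ^ i * dist x y" if "i \<le> n" for i
    using that
  proof (induction i)
    case (Suc i)
    then have IH: "dist ((f ^^ i) x) ((f ^^ i) y) \<le> L ^ i * dist x y" by simp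
    with less[of i] Suc.prems d have "dist ((f ^^ i) x) ((f ^^ i) y) < \<delta>" by simp
    then have "dist (f ((f ^^ i) x)) (f ((f ^^ i) y)) \<le> L * dist ((f ^^ i) x) ((f ^^ i) y)" by (rule exp)
    also have "\<dots> \<le> L * (L ^ i * dist x y)" using IH L by (intro mult_left_mono) auto
    finally show ?case by (simp add: mult.assoc)
  qed simp
  show "y \<in> bowen_ball f x n d"
    unfolding bowen_ball_def using le less by (auto intro: le_less_trans)
qed

text \<open>Membership in the Bowen ball itself supplies the closeness that the local expansion
  bound requires at each step.\<close>

lemma bowen_ball_subset_ball:
  assumes exp: "\<And>x y. dist x y < \<delta> \<Longrightarrow> l * dist x y \<le> dist (f x) (f y)"
    and l: "0 < l" and \<epsilon>: "\<delta> \<le> l ^ n * \<epsilon>"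
  shows "bowen_ball f x n \<delta> \<subseteq> ball x \<epsilon>"
proof
  fix y assume "y \<in> bowen_ball f x n \<delta>"
  then have less: "dist ((f ^^ i) x) ((f ^^ i) y) < \<delta>" if "i \<le> n" for i
    using that by (simp add: bowen_ball_def)
  have "l ^ i * dist x y \<le> dist ((f ^^ i) x) ((f ^^ i) y)" if "i \<le> n" for i
    using that
  proof (induction i)
    case (Suc i)
    then have "l * (l ^ i * dist x y) \<le> l * dist ((f ^^ i) x) ((f ^^ i) y)"
      using l by (intro mult_left_mono) auto
    also have "\<dots> \<le> dist (f ((f ^^ i) x)) (f ((f ^^ i) y))" using less Suc.prems by (intro exp) simp
    finally show ?case by (simp add: mult.assoc)
  qed simp
  from this[of n] less[of n] \<epsilon> have "l ^ n * dist x y < l ^ n * \<epsilon>" by linarith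
  then show "y \<in> ball x \<epsilon>" using l by simp
qed

text \<open>The real solution of \<open>b powr L * \<epsilon> = d\<close> is rounded down for the
  first inequality and up for the second. The threshold \<open>N\<close> lets entropy asymptotics
  apply to the chosen \<open>n\<close>.\<close>

lemma eventually_power_scale:
  fixes b d :: real
  assumes b: "1 < b" and d: "0 < d"
  shows "eventually (\<lambda>\<epsilon>. 0 < \<epsilon> \<and> \<epsilon> < 1
    \<and> (\<exists>n\<ge>N. b ^ n * \<epsilon> \<le> d \<and> \<bar>real n - (ln d - ln \<epsilon>) / ln b\<bar> \<le> 1)
    \<and> (\<exists>n\<ge>N. d \<le> b ^ n * \<epsilon> \<and> \<bar>real n - (ln d - ln \<epsilon>) / ln b\<bar> \<le> 1)) (at_right 0)"
proof -
  \<comment> \<open>The extra 1 absorbs the loss from rounding down.\<close>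
  have "eventually (\<lambda>\<epsilon>::real. ln \<epsilon> < ln d - (real N + 1) * ln b) (at_right 0)"
    using ln_at_0 unfolding filterlim_at_bot_dense by blast
  moreover have "eventually (\<lambda>\<epsilon>::real. 0 < \<epsilon> \<and> \<epsilon> < 1) (at_right 0)"
    using eventually_at_right_less[of "0::real"] eventually_at_right[of 0 "1::real"]
    by (auto simp: eventually_at_right_field intro!: exI[of _ 1])
  ultimately show ?thesis
  proof eventually_elim
    case (elim \<epsilon>)
    define L where "L = (ln d - ln \<epsilon>) / ln b"
    have lnb: "0 < ln b" using b by simp
    have L: "real N + 1 < L" "L * ln b = ln d - ln \<epsilon>"
      using elim(1) lnb by (auto simp: L_def field_simps)
    have ln: "ln (b ^ n * \<epsilon>) = real n * ln b + ln \<epsilon>" for n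
      using b elim(2) by (simp add: ln_mult ln_realpow)
    have pos: "0 < b ^ n * \<epsilon>" for n using b elim(2) by simp
    have "\<exists>n\<ge>N. b ^ n * \<epsilon> \<le> d \<and> \<bar>real n - L\<bar> \<le> 1"
    proof (intro exI conjI)
      let ?n = "nat \<lfloor>L\<rfloor>"
      have n: "real ?n = of_int \<lfloor>L\<rfloor>" using L by simp
      show "N \<le> ?n" "\<bar>real ?n - L\<bar> \<le> 1" using L n by linarith+
      have "real ?n * ln b \<le> L * ln b" using n lnb by (intro mult_right_mono) auto
      then have "ln (b ^ ?n * \<epsilon>) \<le> ln d" using L ln by simp
      then show "b ^ ?n * \<epsilon> \<le> d" using pos d by simp
    qed
    moreover have "\<exists>n\<ge>N. d \<le> b ^ n * \<epsilon> \<and> \<bar>real n - L\<bar> \<le> 1"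
    proof (intro exI conjI)
      let ?n = "nat \<lceil>L\<rceil>"
      have n: "real ?n = of_int \<lceil>L\<rceil>" using L by simp
      show "N \<le> ?n" "\<bar>real ?n - L\<bar> \<le> 1" using L n by linarith+
      have "L * ln b \<le> real ?n * ln b" using n lnb by (intro mult_right_mono) auto
      then have "ln d \<le> ln (b ^ ?n * \<epsilon>)" using L ln by simp
      then show "d \<le> b ^ ?n * \<epsilon>" using pos d by simp
    qed
    ultimately show ?case using elim(2) by (simp add: L_def)
  qed
qed

lemma tendsto_affine_over_ln:
  fixes A C :: real
  shows "((\<lambda>\<epsilon>. A + C / ln \<epsilon>) \<longlongrightarrow> A) (at_right 0)"
proof -
  have "((\<lambda>\<epsilon>::real. C / ln \<epsilon>) \<longlongrightarrow> 0) (at_right 0)"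
    by (rule tendsto_divide_0[OF tendsto_const filterlim_at_bot_imp_at_infinity[OF ln_at_0]])
  then show ?thesis using tendsto_add[OF tendsto_const[of A]] by fastforce
qed

text \<open>At time 0 Bowen balls are metric balls. Some ball of a finite cover has positive
  measure, and homogeneity passes this on to all centres, which also yields full support.\<close>

lemma homogeneous_ball_lower_bound:
  fixes M :: "'a::metric_space measure"
  assumes cpt: "compact (UNIV :: 'a set)" and sets: "sets M = sets borel" and M: "prob_space M"
    and hom: "homogeneous_measure M f" and \<epsilon>: "0 < \<epsilon>"
  obtains m where "0 < m" "\<And>x. m \<le> measure M (ball x \<epsilon>)"
proof -
  interpret prob_space M by fact
  have space: "space M = UNIV" using sets_eq_imp_space_eq[OF sets] by simp
  have bb: "bowen_ball f x 0 r = ball x r" for x r by (simp add: bowen_ball_def ball_def)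
  obtain d c where dc: "0 < d" "0 < c"
    "\<And>x y. measure M (ball y d) \<le> c * measure M (ball x \<epsilon>)"
    using hom \<epsilon> unfolding homogeneous_measure_def bb[symmetric] by meson
  have "(UNIV :: 'a set) \<subseteq> (\<Union>z\<in>UNIV. ball z d)"
  proof
    fix x :: 'a
    have "x \<in> ball x d" using dc by simp
    then show "x \<in> (\<Union>z\<in>UNIV. ball z d)" by blast
  qed
  from compactE_image[OF cpt open_ball this]
  obtain F where F: "finite F" "(UNIV :: 'a set) \<subseteq> (\<Union>z\<in>F. ball z d)"
    by metis
  have "\<exists>y. measure M (ball y d) > 0"
  proof (rule ccontr)
    assume "\<not> ?thesis"
    then have zero: "measure M (ball y d) = 0" for y by (simp add: zero_less_measure_iff)
    have "1 = measure M (\<Union>z\<in>F. ball z d)" using F(2) prob_space by (simp add: space top.extremum_unique)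
    also have "\<dots> \<le> (\<Sum>z\<in>F. measure M (ball z d))"
      using F(1) by (intro finite_measure_subadditive_finite) (auto simp: sets)
    finally show False by (simp add: zero)
  qed
  then obtain y where y: "measure M (ball y d) > 0" by blast
  show thesis
  proof (rule that[of "measure M (ball y d) / c"])
    show "0 < measure M (ball y d) / c" using y dc by simp
    show "measure M (ball y d) / c \<le> measure M (ball x \<epsilon>)" for x
      using dc(3)[of y x] dc(2) by (simp add: field_simps)
  qed
qed

section \<open>Homogeneous measures of expanding maps\<close>

locale homogeneous_system = prob_space M for M :: "'a::metric_space measure" +
  fixes f :: "'a \<Rightarrow> 'a" and \<delta> :: real
  assumes compact_UNIV: "compact (UNIV :: 'a set)"
    and continuous_f: "continuous_on UNIV f"
    and sets_borel: "sets M = sets borel"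
    and invariant: "invariant_measure M f"
    and homogeneous: "homogeneous_measure M f"
    and \<delta>_pos: "0 < \<delta>"
begin

lemma measure_ball_pos: "0 < r \<Longrightarrow> 0 < measure M (ball x r)"
  by (rule homogeneous_ball_lower_bound[OF compact_UNIV sets_borel prob_space_axioms homogeneous, of r])
    (auto intro: less_le_trans)

lemma measure_open_pos:
  assumes "open U" "x \<in> U"
  shows "0 < measure M U"
proof -
  obtain r where r: "0 < r" "ball x r \<subseteq> U" using assms open_contains_ball by blast
  have "measure M (ball x r) \<le> measure M U"
    using r assms by (intro finite_measure_mono) (auto simp: sets_borel)
  with measure_ball_pos[OF r(1), of x] show ?thesis by linarith
qed

lemma bowen_ball_sets: "bowen_ball f x n r \<in> sets M"
  using open_bowen_ball[OF continuous_f] by (simp add: sets_borel)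

lemma measure_bowen_ball_pos: "0 < r \<Longrightarrow> 0 < measure M (bowen_ball f x n r)"
  by (rule measure_open_pos[OF open_bowen_ball[OF continuous_f] bowen_ball_center])

lemma measure_support_UNIV: "measure_support M = UNIV"
  using measure_open_pos by (auto simp: measure_support_def emeasure_eq_measure)

lemma ex_positive_balls:
  assumes "0 < \<epsilon>" "\<epsilon> < 1"
  obtains m where "positive_balls M \<epsilon> m"
proof -
  obtain m where "0 < m" "\<And>x. m \<le> measure M (ball x \<epsilon>)"
    by (rule homogeneous_ball_lower_bound[OF compact_UNIV sets_borel prob_space_axioms homogeneous assms(1)])
      (rule that)
  then have "positive_balls M \<epsilon> m"
    using assms sets_borel measure_support_UNIV by unfold_locales auto
  then show thesis by (rule that)
qed

lemma dimension_chain: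
  assumes "s < 1" "1 < q"
  shows "lower_dimension M q \<le> lower_dimension M 1" "upper_dimension M 1 \<le> upper_dimension M s"
proof -
  have ev: "eventually (\<lambda>\<epsilon>::real. 0 < \<epsilon> \<and> \<epsilon> < 1) (at_right 0)"
    using eventually_power_scale[of 2 1 0] by (auto elim: eventually_mono)
  show "lower_dimension M q \<le> lower_dimension M 1"
    unfolding lower_dimension_def
  proof (rule Liminf_mono, rule eventually_mono[OF ev])
    fix \<epsilon> :: real assume "0 < \<epsilon> \<and> \<epsilon> < 1"
    then obtain m where "positive_balls M \<epsilon> m" using ex_positive_balls by blast
    from positive_balls.dimension_quotient_le_1[OF this assms(2)]
    show "ereal (dimension_quotient M q \<epsilon>) \<le> ereal (dimension_quotient M 1 \<epsilon>)" by simp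
  qed
  show "upper_dimension M 1 \<le> upper_dimension M s"
    unfolding upper_dimension_def
  proof (rule Limsup_mono, rule eventually_mono[OF ev])
    fix \<epsilon> :: real assume "0 < \<epsilon> \<and> \<epsilon> < 1"
    then obtain m where "positive_balls M \<epsilon> m" using ex_positive_balls by blast
    from positive_balls.dimension_quotient_ge_1[OF this assms(1)]
    show "ereal (dimension_quotient M 1 \<epsilon>) \<le> ereal (dimension_quotient M s \<epsilon>)" by simp
  qed
qed

section \<open>Entropy against dimension\<close>

lemma entropy_wrt_partition_le_lower_dimension:
  assumes Lam: "1 < Lam" and q: "1 < q"
    and exp: "\<And>x y. dist x y < \<delta> \<Longrightarrow> dist (f x) (f y) \<le> Lam * dist x y"
    and P: "finite_measurable_partition M P"
    and a: "a < entropy_wrt_partition M f P"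
  shows "ereal (a / ln Lam) \<le> lower_dimension M q"
proof -
  define H where "H n = shannon_entropy (itinerary f (partition_atom P) n)" for n
  \<comment> \<open>The gap between \<open>a\<close> and the entropy is halved: one half is the
    error rate in the Bowen ball bound, the other the error in the convergence of
    \<open>H n / real n\<close>.\<close>
  define \<eta> where "\<eta> = (entropy_wrt_partition M f P - a) / 2"
  have \<eta>: "0 < \<eta>" using a by (simp add: \<eta>_def)
  obtain r where r: "0 < r"
    "\<And>n m. 0 < m \<Longrightarrow> (\<And>x. m \<le> measure M (bowen_ball f x n r)) \<Longrightarrow> H n \<le> - ln m + real n * \<eta>"
    unfolding H_def
    by (rule entropy_le_of_bowen_balls[OF compact_UNIV continuous_f sets_borel prob_space_axioms
        invariant P \<eta>]) blast
  obtain d' c where d': "0 < d'" "0 < c"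
    "\<And>n x y. measure M (bowen_ball f y n d') \<le> c * measure M (bowen_ball f x n r)"
    using homogeneous r(1) unfolding homogeneous_measure_def by meson
  \<comment> \<open>The minimum with \<open>\<delta>\<close> keeps the balls inside the range of the
    Lipschitz bound.\<close>
  define d where "d = min d' \<delta>"
  have d: "0 < d" "d \<le> \<delta>" using d' \<delta>_pos by (auto simp: d_def)
  \<comment> \<open>The measure of one \<open>d\<close>-ball divided by \<open>c\<close> is a lower
    bound for the \<open>r\<close>-balls at all centres, so the covering estimate for
    \<open>H n\<close> becomes an upper bound for that single measure.\<close>
  have ln_le: "ln (measure M (bowen_ball f x n d)) \<le> ln c - H n + real n * \<eta>" for x n
  proof -
    let ?m = "measure M (bowen_ball f x n d)"
    have m: "0 < ?m" using d by (intro measure_bowen_ball_pos)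
    have "bowen_ball f x n d \<subseteq> bowen_ball f x n d'" by (auto simp: bowen_ball_def d_def)
    then have "?m \<le> measure M (bowen_ball f x n d')"
      by (intro finite_measure_mono bowen_ball_sets)
    then have "?m / c \<le> measure M (bowen_ball f y n r)" for y
      using d'(2) d'(3)[of x n y] by (simp add: field_simps)
    then have "H n \<le> - ln (?m / c) + real n * \<eta>" using m d'(2) by (intro r(2)) auto
    then show ?thesis using m d'(2) by (simp add: ln_div)
  qed
  have "(\<lambda>n. H n / real n) \<longlonglongrightarrow> entropy_wrt_partition M f P"
    unfolding H_def by (rule entropy_wrt_partition_LIMSEQ[OF prob_space_axioms invariant P])
  then have "eventually (\<lambda>n. entropy_wrt_partition M f P - \<eta> < H n / real n) sequentially"
    using \<eta> by (intro order_tendstoD) auto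
  then obtain N where N: "\<And>n. n \<ge> N \<Longrightarrow> a + \<eta> < H n / real n"
    unfolding eventually_sequentially \<eta>_def by (auto simp: field_simps)
  \<comment> \<open>Collects what does not depend on \<open>\<epsilon>\<close>: \<open>ln c\<close>
    from homogeneity, \<open>\<bar>a\<bar>\<close> from rounding \<open>n\<close>, and the offset of
    the scale \<open>d\<close>.\<close>
  define K where "K = ln c + \<bar>a\<bar> - a * ln d / ln Lam"
  have "eventually (\<lambda>\<epsilon>. ereal (a / ln Lam + K / ln \<epsilon>) \<le> ereal (dimension_quotient M q \<epsilon>)) (at_right 0)"
    using eventually_power_scale[OF Lam d(1), of "max N 1"]
  proof eventually_elim
    case (elim \<epsilon>)
    then obtain n where n: "max N 1 \<le> n" "Lam ^ n * \<epsilon> \<le> d" "\<bar>real n - (ln d - ln \<epsilon>) / ln Lam\<bar> \<le> 1"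
      and \<epsilon>: "0 < \<epsilon>" "\<epsilon> < 1" by blast
    obtain m where pb: "positive_balls M \<epsilon> m" using ex_positive_balls[OF \<epsilon>] .
    have b: "ln (measure M (ball x \<epsilon>)) \<le> K + a / ln Lam * ln \<epsilon>" for x
    proof -
      have "ball x \<epsilon> \<subseteq> bowen_ball f x n d"
        using Lam by (intro ball_subset_bowen_ball[where \<delta> = \<delta> and L = Lam] exp d n) auto
      then have "measure M (ball x \<epsilon>) \<le> measure M (bowen_ball f x n d)"
        by (intro finite_measure_mono bowen_ball_sets)
      then have "ln (measure M (ball x \<epsilon>)) \<le> ln (measure M (bowen_ball f x n d))"
        using \<epsilon> by (intro ln_mono measure_ball_pos)
      also have "\<dots> \<le> ln c - H n + real n * \<eta>" by (rule ln_le)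
      also have "\<dots> \<le> ln c - a * real n"
        using N[of n] n(1) by (simp add: field_simps)
      also have "\<dots> \<le> ln c + \<bar>a\<bar> - a * ((ln d - ln \<epsilon>) / ln Lam)"
      proof -
        have "\<bar>a * (real n - (ln d - ln \<epsilon>) / ln Lam)\<bar> \<le> \<bar>a\<bar> * 1"
          unfolding abs_mult using n(3) by (intro mult_left_mono) auto
        then show ?thesis by (simp add: right_diff_distrib)
      qed
      also have "\<dots> = K + a / ln Lam * ln \<epsilon>" by (simp add: K_def diff_divide_distrib right_diff_distrib)
      finally show ?thesis .
    qed
    have "(K + a / ln Lam * ln \<epsilon>) / ln \<epsilon> \<le> dimension_quotient M q \<epsilon>"
      by (rule positive_balls.dimension_quotient_ge[OF pb q b])
    then show ?case using positive_balls.ln_\<epsilon>_neg[OF pb] by (simp add: add_divide_distrib add.commute)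
  qed
  then have "Liminf (at_right 0) (\<lambda>\<epsilon>. ereal (a / ln Lam + K / ln \<epsilon>)) \<le> lower_dimension M q"
    unfolding lower_dimension_def by (rule Liminf_mono)
  moreover have "Liminf (at_right 0) (\<lambda>\<epsilon>. ereal (a / ln Lam + K / ln \<epsilon>)) = ereal (a / ln Lam)"
    by (intro lim_imp_Liminf tendsto_ereal tendsto_affine_over_ln) simp
  ultimately show ?thesis by simp
qed

lemma upper_dimension_le_entropy_wrt_partition:
  assumes lam: "1 < lam" and s: "s < 1"
    and exp: "\<And>x y. dist x y < \<delta> \<Longrightarrow> lam * dist x y \<le> dist (f x) (f y)"
  obtains P where "finite_measurable_partition M P"
    "\<And>a. entropy_wrt_partition M f P < a \<Longrightarrow> upper_dimension M s \<le> ereal (a / ln lam)"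
proof -
  have f: "f \<in> measurable M M" using invariant by (simp add: invariant_measure_def)
  obtain d c where d: "0 < d" "0 < c"
    "\<And>n x y. measure M (bowen_ball f y n d) \<le> c * measure M (bowen_ball f x n \<delta>)"
    using homogeneous \<delta>_pos unfolding homogeneous_measure_def by meson
  obtain P where P: "finite_measurable_partition M P"
    and PH: "\<And>n p. (\<And>x. measure M (bowen_ball f x n d) \<le> p) \<Longrightarrow>
      (\<And>x. bowen_ball f x n d \<in> sets M) \<Longrightarrow>
      - ln p \<le> shannon_entropy (itinerary f (partition_atom P) (Suc n))"
    by (rule entropy_ge_of_bowen_balls[OF compact_UNIV sets_borel prob_space_axioms f d(1)]) blast
  define H where "H n = shannon_entropy (itinerary f (partition_atom P) n)" for n
  have ln_ge: "- ln c - H (Suc n) \<le> ln (measure M (bowen_ball f x n \<delta>))" for x n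
  proof -
    \<comment> \<open>For the fixed centre \<open>x\<close>, homogeneity makes \<open>c\<close>
      times its measure a common bound \<open>p\<close> for the \<open>d\<close>-balls at all
      centres.\<close>
    have "- ln (c * measure M (bowen_ball f x n \<delta>)) \<le> H (Suc n)"
      unfolding H_def by (intro PH d(3) bowen_ball_sets)
    then show ?thesis using d(2) measure_bowen_ball_pos[OF \<delta>_pos, of x n] by (simp add: ln_mult)
  qed
  have "upper_dimension M s \<le> ereal (a / ln lam)" if a: "entropy_wrt_partition M f P < a" for a
  proof -
    have "(\<lambda>n. H n / real n) \<longlonglongrightarrow> entropy_wrt_partition M f P"
      unfolding H_def by (rule entropy_wrt_partition_LIMSEQ[OF prob_space_axioms invariant P])
    then have "eventually (\<lambda>n. H n / real n < a) sequentially"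
      using a by (intro order_tendstoD) auto
    then obtain N where N: "\<And>n. n \<ge> N \<Longrightarrow> H n / real n < a"
      unfolding eventually_sequentially by blast
    \<comment> \<open>One \<open>\<bar>a\<bar>\<close> pays for rounding \<open>n\<close>, the other
      for \<open>Suc n\<close> in place of \<open>n\<close>.\<close>
    define K where "K = - ln c - 2 * \<bar>a\<bar> - a * ln \<delta> / ln lam"
    have "eventually (\<lambda>\<epsilon>. ereal (dimension_quotient M s \<epsilon>) \<le> ereal (a / ln lam + K / ln \<epsilon>)) (at_right 0)"
      using eventually_power_scale[OF lam \<delta>_pos, of N]
    proof eventually_elim
      case (elim \<epsilon>)
      then obtain n where n: "N \<le> n" "\<delta> \<le> lam ^ n * \<epsilon>" "\<bar>real n - (ln \<delta> - ln \<epsilon>) / ln lam\<bar> \<le> 1"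
        and \<epsilon>: "0 < \<epsilon>" "\<epsilon> < 1" by blast
      obtain m where pb: "positive_balls M \<epsilon> m" using ex_positive_balls[OF \<epsilon>] .
      have b: "K + a / ln lam * ln \<epsilon> \<le> ln (measure M (ball x \<epsilon>))" for x
      proof -
        have "K + a / ln lam * ln \<epsilon> = - ln c - 2 * \<bar>a\<bar> - a * ((ln \<delta> - ln \<epsilon>) / ln lam)"
          by (simp add: K_def diff_divide_distrib right_diff_distrib)
        also have "\<dots> \<le> - ln c - a * real (Suc n)"
        proof -
          have "\<bar>a * (real n - (ln \<delta> - ln \<epsilon>) / ln lam)\<bar> \<le> \<bar>a\<bar> * 1"
            unfolding abs_mult using n(3) by (intro mult_left_mono) auto
          then show ?thesis by (simp add: right_diff_distrib distrib_left)
        qed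
        also have "\<dots> \<le> - ln c - H (Suc n)"
          using N[of "Suc n"] n(1) by (simp add: field_simps)
        also have "\<dots> \<le> ln (measure M (bowen_ball f x n \<delta>))" by (rule ln_ge)
        also have "\<dots> \<le> ln (measure M (ball x \<epsilon>))"
        proof (rule ln_mono)
          have "bowen_ball f x n \<delta> \<subseteq> ball x \<epsilon>"
            using lam by (intro bowen_ball_subset_ball[where l = lam] exp n) auto
          then show "measure M (bowen_ball f x n \<delta>) \<le> measure M (ball x \<epsilon>)"
            by (intro finite_measure_mono) (auto simp: sets_borel)
        qed (use measure_bowen_ball_pos[OF \<delta>_pos] in auto)
        finally show ?thesis .
      qed
      have "dimension_quotient M s \<epsilon> \<le> (K + a / ln lam * ln \<epsilon>) / ln \<epsilon>"
        by (rule positive_balls.dimension_quotient_le[OF pb s b])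
      then show ?case using positive_balls.ln_\<epsilon>_neg[OF pb] by (simp add: add_divide_distrib add.commute)
    qed
    then have "upper_dimension M s \<le> Limsup (at_right 0) (\<lambda>\<epsilon>. ereal (a / ln lam + K / ln \<epsilon>))"
      unfolding upper_dimension_def by (rule Limsup_mono)
    also have "\<dots> = ereal (a / ln lam)"
      by (intro lim_imp_Limsup tendsto_ereal tendsto_affine_over_ln) simp
    finally show ?thesis .
  qed
  with P show thesis by (rule that)
qed

text \<open>Clearing the denominator lets the supremum be bounded partition by partition. The
  estimate for one partition needs \<open>a\<close> strictly below its entropy; the slack
  \<open>e * ln Lam\<close> becomes an arbitrary \<open>e\<close> after division.\<close>

lemma metric_entropy_le_lower_dimension:
  assumes Lam: "1 < Lam" and q: "1 < q"
    and exp: "\<And>x y. dist x y < \<delta> \<Longrightarrow> dist (f x) (f y) \<le> Lam * dist x y"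
  shows "metric_entropy M f / ereal (ln Lam) \<le> lower_dimension M q"
proof -
  have l: "0 < ln Lam" using Lam by simp
  have "ereal (entropy_wrt_partition M f P) \<le> ereal (ln Lam) * lower_dimension M q"
    if P: "finite_measurable_partition M P" for P
  proof -
    let ?h = "entropy_wrt_partition M f P"
    have "ereal (?h / ln Lam) \<le> lower_dimension M q"
    proof (rule ereal_le_epsilon2)
      fix e :: real assume e: "0 < e"
      have "ereal ((?h - e * ln Lam) / ln Lam) \<le> lower_dimension M q"
        using e l by (intro entropy_wrt_partition_le_lower_dimension[OF Lam q exp P]) auto
      then have "ereal (?h / ln Lam - e) + ereal e \<le> lower_dimension M q + ereal e"
        using l by (intro add_right_mono) (simp add: diff_divide_distrib)
      then show "ereal (?h / ln Lam) \<le> lower_dimension M q + ereal e" by simp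
    qed
    then have "ereal ?h / ereal (ln Lam) \<le> lower_dimension M q" using l by simp
    then show ?thesis using l by (subst (asm) ereal_divide_le_pos) auto
  qed
  then have "metric_entropy M f \<le> ereal (ln Lam) * lower_dimension M q"
    unfolding metric_entropy_def by (intro SUP_least) auto
  then show ?thesis using l by (subst ereal_divide_le_pos) auto
qed

text \<open>One partition is enough here, because its entropy is below the supremum.\<close>

lemma upper_dimension_le_metric_entropy:
  assumes lam: "1 < lam" and s: "s < 1"
    and exp: "\<And>x y. dist x y < \<delta> \<Longrightarrow> lam * dist x y \<le> dist (f x) (f y)"
  shows "upper_dimension M s \<le> metric_entropy M f / ereal (ln lam)"
proof -
  have l: "0 < ln lam" using lam by simp
  obtain P where P: "finite_measurable_partition M P"
    and le: "\<And>a. entropy_wrt_partition M f P < a \<Longrightarrow> upper_dimension M s \<le> ereal (a / ln lam)"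
    by (rule upper_dimension_le_entropy_wrt_partition[OF lam s exp]) (assumption, rule that)
  let ?h = "entropy_wrt_partition M f P"
  have "upper_dimension M s \<le> ereal (?h / ln lam)"
  proof (rule ereal_le_epsilon2)
    fix e :: real assume e: "0 < e"
    have "upper_dimension M s \<le> ereal ((?h + e * ln lam) / ln lam)"
      using e l by (intro le) auto
    then show "upper_dimension M s \<le> ereal (?h / ln lam) + ereal e"
      using l by (simp add: add_divide_distrib)
  qed
  also have "\<dots> = ereal ?h / ereal (ln lam)" using l by simp
  also have "\<dots> \<le> metric_entropy M f / ereal (ln lam)"
    using l P unfolding metric_entropy_def
    by (intro ereal_divide_right_mono SUP_upper) auto
  finally show ?thesis .
qed

end

theorem corollary1p1:
  fixes f :: "'a::metric_space \<Rightarrow> 'a"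
    and \<mu> :: "'a measure"
    and Lam lam \<delta> s q :: real
  assumes "compact (UNIV :: 'a set)"
    and "continuous_on UNIV f"
    and "sets \<mu> = sets borel"
    and "prob_space \<mu>"
    and "invariant_measure \<mu> f"
    and "homogeneous_measure \<mu> f"
    and "Lam > 1" and "lam > 1" and "\<delta> > 0"
    and "\<And>x y. dist x y < \<delta> \<Longrightarrow>
           lam * dist x y \<le> dist (f x) (f y) \<and> dist (f x) (f y) \<le> Lam * dist x y"
    and "s < 1" and "q > 1"
  shows "metric_entropy \<mu> f / ereal (ln Lam) \<le> lower_dimension \<mu> q
    \<and> lower_dimension \<mu> q \<le> lower_dimension \<mu> 1
    \<and> lower_dimension \<mu> 1 \<le> upper_dimension \<mu> 1
    \<and> upper_dimension \<mu> 1 \<le> upper_dimension \<mu> s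
    \<and> upper_dimension \<mu> s \<le> metric_entropy \<mu> f / ereal (ln lam)"
proof -
  interpret homogeneous_system \<mu> f \<delta>
    using assms by (intro homogeneous_system.intro homogeneous_system_axioms.intro)
  have "lower_dimension \<mu> 1 \<le> upper_dimension \<mu> 1"
    unfolding lower_dimension_def upper_dimension_def by (intro Liminf_le_Limsup) simp
  then show ?thesis
    using assms dimension_chain metric_entropy_le_lower_dimension upper_dimension_le_metric_entropy
    by meson
qed

end
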